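(* Let $\{x_k\}$ be generated by Algorithm PSG_LECO (described in the context) applied to $\min_{x\in S} f(x)=\frac1N\sum_{i=1}^N f_i(x)$, $S=\{x\in\mathbb{R}^n : Ax=b\}$. Suppose that: (1) $f:\mathbb{R}^n\to\mathbb{R}$ is continuously differentiable on $\mathbb{R}^n$ and $\nabla f$ is Lipschitz continuous with constant $L>0$; (2) there is $f^*\in\mathbb{R}$ with $f(x)\ge f^*$ for all $x\in\mathbb{R}^n$; (3) the nonnegative sequence $\{\eta_k\}$ satisfies $\eta_k\le\eta<1$ for all $k\ge 0$, and the nonnegative sequence $\{\mu_k\}$ converges to zero R-linearly; (4) for some positive constant $\kappa_{\nabla}$, the sequence $\{x_k\}$ is either feasible (i.e. $x_k\in S$ for all $k\ge 0$) or such that $\|\nabla f(x_k)\|\le\kappa_{\nabla}$ for all $k\ge 0$; (5) there is a constant $\nu>0$ such that $\mathbb{E}\big[\|g_k-\nabla f(x_k)\|^2\,|\,\mathcal{F}_k\big]\le\nu$ for all $k\ge 0$. If $\alpha_k=\alpha$ for all $k\ge 0$, with $\alpha$ such that $$0<\alpha\le\frac{\delta_\ell}{2L\delta_u^2},$$ then the iterates generated by PSG_LECO satisfy $$\lim_{K\to\infty}\ \mathbb{E}\left[\frac1K\sum_{k=0}^K\|d(x_k)\|^2\right]\le\frac{\alpha L\kappa_2\delta_u^2}{\delta_\ell},$$ where $d(x)=\pi_S(x-\nabla f(x))-x$ and $\kappa_2>0$ is a constant for which, together with some positive constants $\kappa_3,\kappa_4$ and some $q\in(\eta,1)$, $$\mathbb{E}\big[\|x_{k+1}-x_k\|^2\,|\,\mathcal{F}_k\big]\le\kappa_2\Delta_k^2+\kappa_3q^{2k}+\kappa_4\mu_k+2\Delta_k^2\|d(x_k)\|^2\qquad\text{for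 all }k\ge 0$$ (such constants exist under the stated hypotheses).
   Context: Problem data: $f_i:\mathbb{R}^n\to\mathbb{R}$, $i=1,\dots,N$, are continuously differentiable, $A\in\mathbb{R}^{m\times n}$ with $m<n$ has full row rank, $b\in\mathbb{R}^m$, $f=\frac1N\sum_{i=1}^N f_i$, $S=\{x: Ax=b\}$. $\|\cdot\|$ is the Euclidean norm. Projections: the orthogonal projection onto $S$ is $\pi_S(y)=y-A^T(AA^T)^{-1}(Ay-b)$. An inexact projection is $\widetilde\pi_S(y)=y-A^T\widetilde\lambda(y)$ with $\widetilde\lambda(y)=(AA^T)^{-1}(Ay-b+r(y))$, where $r(y)\in\mathbb{R}^m$ is the residual in the approximate solution of $AA^T\widetilde\lambda(y)=Ay-b$. Algorithm PSG_LECO. Inputs: an initial iterate $x_0\in\mathbb{R}^n$, a prescribed positive sequence $\{\alpha_k\}$, prescribed nonnegative sequences $\{\eta_k\}$, $\{\mu_k\}$ with $\eta_k\in[0,\eta)$ and $\eta<1$, scalars $0<\delta_\ell<\delta_u<\infty$, and an initial step-size $\Delta_0\in[\alpha_0\delta_\ell,\alpha_0\delta_u]$. For $k=0,1,\dots$: (i) given a partition $\mathcal{N}_k^1,\dots,\mathcal{N}_k^r$ of $\{1,\dots,N\}$ into $r$ disjoint mini-batches (fixed or varying with $k$), select, conditionally on $\mathcal{F}_k$, an index $i\in\{1,\dots,r\}$ uniformly at random (each with probability $1/r$) and set $g_k=\frac{r}{N}\sum_{j\in\mathcal{N}_k^i}\nabla f_j(x_k)$, so that $\mathbb{E}[g_k|\mathcal{F}_k]=\nabla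 f(x_k)$; (ii) set $y_k=x_k-\Delta_k g_k$; (iii) set $x_{k+1}=\widetilde\pi_S(y_k)$, where the residual satisfies $\|r(y_k)\|\le\eta_k\|Ax_k-b\|+\mu_k$; (iv) choose a scalar $\delta_k$ and set $\Delta_{k+1}=\alpha_{k+1}\max\{\delta_\ell,\min\{\delta_k,\delta_u\}\}$. Here $\mathcal{F}_k$ is the $\sigma$-algebra generated by $x_0,\dots,x_k$ (i.e. by $g_0,\dots,g_{k-1}$), and $\Delta_k$ is $\mathcal{F}_k$-measurable. A nonnegative sequence $\{\mu_k\}$ converges to zero R-linearly if there are $C>0$ and $\rho\in(0,1)$ with $\mu_k\le C\rho^k$ for all $k$.
   Formalization: The limit over K is replaced by the limit superior, since δ_k is arbitrary and the averaged expectations may oscillate so that the limit need not exist; whenever the limit exists the stated bound holds for it. *)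

theory Defs
  imports "HOL-Probability.Probability"
begin

definition grad :: "(real^'n \<Rightarrow> real) \<Rightarrow> real^'n \<Rightarrow> real^'n" where
  "grad h x = (THE D. GDERIV h x :> D)"

definition cont_diff :: "(real^'n \<Rightarrow> real) \<Rightarrow> bool" where
  "cont_diff h \<longleftrightarrow> (\<forall>x. h differentiable (at x)) \<and> continuous_on UNIV (grad h)"

lemma GDERIV_grad:
  assumes "h differentiable (at x)"
  shows "GDERIV h x :> grad h x"
proof -
  obtain h' where h': "(h has_derivative h') (at x)"
    using assms unfolding differentiable_def by blast
  then interpret bounded_linear h' by (rule has_derivative_bounded_linear)
  have "h' v = v \<bullet> adjoint h' 1" for v
    using adjoint_works[OF linear_axioms, of v 1] by simp
  then have "GDERIV h x :> adjoint h' 1"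
    using h' unfolding gderiv_def by (metis (no_types, lifting) ext)
  moreover have "D = adjoint h' 1" if "GDERIV h x :> D" for D
  proof (rule vector_eq_ldot[THEN iffD1, rule_format])
    fix v show "v \<bullet> D = v \<bullet> adjoint h' 1"
      using has_derivative_unique that \<open>GDERIV h x :> adjoint h' 1\<close>
      unfolding gderiv_def by metis
  qed
  ultimately show ?thesis
    unfolding grad_def by (rule theI)
qed

definition avg_fun :: "nat \<Rightarrow> (nat \<Rightarrow> real^'n \<Rightarrow> real) \<Rightarrow> real^'n \<Rightarrow> real" where
  "avg_fun N f x = (1 / real N) * (\<Sum>i=1..N. f i x)"

definition feasible_set :: "real^'n^'m \<Rightarrow> real^'m \<Rightarrow> (real^'n) set" where
  "feasible_set A b = {x. A *v x = b}"

text \<open>The argument \<open>\<rho>\<close> is the residual of the approximate solution \<open>\<lambda>\<close> of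
  \<open>A A\<^sup>T \<lambda> = A y - b\<close>.\<close>

definition inexact_proj :: "real^'n^'m \<Rightarrow> real^'m \<Rightarrow> real^'m \<Rightarrow> real^'n \<Rightarrow> real^'n" where
  "inexact_proj A b \<rho> y =
     y - transpose A *v (matrix_inv (A ** transpose A) *v (A *v y - b + \<rho>))"

definition proj :: "real^'n^'m \<Rightarrow> real^'m \<Rightarrow> real^'n \<Rightarrow> real^'n" where
  "proj A b y = y - transpose A *v (matrix_inv (A ** transpose A) *v (A *v y - b))"

lemma invertible_gram:
  fixes A :: "real^'n^'m"
  assumes "rank A = CARD('m)"
  shows "invertible (A ** transpose A)"
proof -
  have inj: "inj ((*v) (transpose A))"
    using assms full_rank_injective[of "transpose A"] by (simp add: rank_transpose)
  have "v = 0" if "(A ** transpose A) *v v = 0" for v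
  proof -
    have "(transpose A *v v) \<bullet> (transpose A *v v) = ((A ** transpose A) *v v) \<bullet> v"
      by (metis dot_lmul_matrix inner_commute matrix_vector_mul_assoc transpose_matrix_vector
          vector_transpose_matrix)
    then have "transpose A *v v = transpose A *v 0"
      using that by simp
    then show "v = 0"
      using inj by (rule injD[rotated])
  qed
  then show ?thesis
    using invertible_left_inverse matrix_left_invertible_ker by blast
qed

lemma proj_eq_closest_point:
  fixes A :: "real^'n^'m"
  assumes "rank A = CARD('m)"
  shows "proj A b y = closest_point (feasible_set A b) y"
proof (rule closest_point_unique)
  let ?w = "matrix_inv (A ** transpose A) *v (A *v y - b)"
  have "(A ** transpose A) ** matrix_inv (A ** transpose A) = mat 1"
    using invertible_gram[OF assms] unfolding invertible_def matrix_inv_def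
    by (rule someI_ex[THEN conjunct1])
  then have inv: "(A ** transpose A) *v ?w = A *v y - b"
    by (simp only: matrix_vector_mul_assoc matrix_vector_mul_lid)
  show "convex (feasible_set A b)"
    unfolding feasible_set_def convex_def
    by (auto simp: matrix_vector_right_distrib matrix_vector_mult_scaleR
        simp flip: scaleR_left_distrib)
  have "closed ((\<lambda>x. A *v x) -` {b})"
    by (intro closed_vimage closed_singleton matrix_vector_mult_linear_continuous_on)
  then show "closed (feasible_set A b)"
    by (simp add: feasible_set_def vimage_def)
  have "A *v (transpose A *v ?w) = A *v y - b"
    using inv by (simp only: matrix_vector_mul_assoc matrix_mul_assoc)
  then have "A *v (y - transpose A *v ?w) = b"
    by (subst matrix_vector_mult_diff_distrib) simp
  then show mem: "proj A b y \<in> feasible_set A b"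
    by (simp only: feasible_set_def proj_def mem_Collect_eq)
  show "\<forall>z\<in>feasible_set A b. dist y (proj A b y) \<le> dist y z"
  proof
    fix z assume z: "z \<in> feasible_set A b"
    let ?u = "transpose A *v ?w" and ?v = "proj A b y - z"
    have "A *v ?v = 0"
      using z mem by (simp add: feasible_set_def matrix_vector_mult_diff_distrib)
    then have orth: "?u \<bullet> ?v = 0"
      by (metis dot_lmul_matrix inner_zero_right transpose_matrix_vector)
    have "y - z = ?u + ?v"
      by (simp add: proj_def)
    then have "(norm (y - z))\<^sup>2 = (norm ?u)\<^sup>2 + (norm ?v)\<^sup>2"
      using norm_add_Pythagorean[of ?u ?v] orth by (simp only: orthogonal_def)
    then have "norm ?u \<le> norm (y - z)"
      by (metis le_add_same_cancel1 norm_ge_zero power2_le_imp_le zero_le_power2)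
    then show "dist y (proj A b y) \<le> dist y z"
      by (simp add: dist_norm proj_def)
  qed
qed

definition proj_grad_dir ::
  "real^'n^'m \<Rightarrow> real^'m \<Rightarrow> (real^'n \<Rightarrow> real) \<Rightarrow> real^'n \<Rightarrow> real^'n" where
  "proj_grad_dir A b h x = proj A b (x - grad h x) - x"

definition R_linear_to_zero :: "(nat \<Rightarrow> real) \<Rightarrow> bool" where
  "R_linear_to_zero \<mu> \<longleftrightarrow> (\<exists>C>0. \<exists>\<rho>. 0 < \<rho> \<and> \<rho> < 1 \<and> (\<forall>k. \<mu> k \<le> C * \<rho> ^ k))"

definition history :: "'w measure \<Rightarrow> (nat \<Rightarrow> 'w \<Rightarrow> real^'n) \<Rightarrow> nat \<Rightarrow> 'w measure" where
  "history M x k = sigma (space M) (\<Union>j\<in>{..k}. {x j -` B \<inter> space M | B. B \<in> sets borel})"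

text \<open>A run of PSG\_LECO on the probability space \<open>M\<close>: \<open>r\<close> is the number of mini-batches,
  \<open>batch k \<omega> j\<close> the \<open>j\<close>-th mini-batch at iteration \<open>k\<close>, \<open>idx k\<close> the sampled mini-batch
  index, and \<open>res k\<close> the residual \<open>r(y\<^sub>k)\<close>. The partition may depend on the past iterates.\<close>

locale psg_leco = prob_space M
  for M :: "'w measure" +
  fixes N :: nat
    and f :: "nat \<Rightarrow> real^'n \<Rightarrow> real"
    and A :: "real^'n^'m"
    and b :: "real^'m"
    and x0 :: "real^'n"
    and \<alpha> \<eta> \<mu> :: "nat \<Rightarrow> real"
    and \<delta>l \<delta>u \<Delta>0 :: real
    and r :: nat
    and batch :: "nat \<Rightarrow> 'w \<Rightarrow> nat \<Rightarrow> nat set"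
    and idx :: "nat \<Rightarrow> 'w \<Rightarrow> nat"
    and g y :: "nat \<Rightarrow> 'w \<Rightarrow> real^'n"
    and res :: "nat \<Rightarrow> 'w \<Rightarrow> real^'m"
    and \<delta> \<Delta> :: "nat \<Rightarrow> 'w \<Rightarrow> real"
    and x :: "nat \<Rightarrow> 'w \<Rightarrow> real^'n"
  assumes N_pos: "0 < N"
    and f_cont_diff: "\<And>i. i \<in> {1..N} \<Longrightarrow> cont_diff (f i)"
    and m_less_n: "CARD('m) < CARD('n)"
    and full_row_rank: "rank A = CARD('m)"
    and \<alpha>_pos: "\<And>k. 0 < \<alpha> k"
    and \<eta>_nonneg: "\<And>k. 0 \<le> \<eta> k"
    and \<mu>_nonneg: "\<And>k. 0 \<le> \<mu> k"
    and \<delta>_bounds: "0 < \<delta>l" "\<delta>l < \<delta>u"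
    and \<Delta>0_bounds: "\<alpha> 0 * \<delta>l \<le> \<Delta>0" "\<Delta>0 \<le> \<alpha> 0 * \<delta>u"
    and x_random: "\<And>k. random_variable borel (x k)"
    and x_init: "\<And>\<omega>. \<omega> \<in> space M \<Longrightarrow> x 0 \<omega> = x0"
    and \<Delta>_init: "\<And>\<omega>. \<omega> \<in> space M \<Longrightarrow> \<Delta> 0 \<omega> = \<Delta>0"
    and batch_partition:
      "\<And>k \<omega>. \<omega> \<in> space M \<Longrightarrow>
         partition_on {1..N} (batch k \<omega> ` {1..r}) \<and> inj_on (batch k \<omega>) {1..r}"
    and batch_measurable:
      "\<And>k j. j \<in> {1..r} \<Longrightarrow>
         (\<lambda>\<omega>. batch k \<omega> j) \<in> measurable (history M x k) (count_space (Pow {1..N}))"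
    and idx_random: "\<And>k. random_variable (count_space {1..r}) (idx k)"
    and idx_uniform:
      "\<And>k j. j \<in> {1..r} \<Longrightarrow>
         AE \<omega> in M. real_cond_exp M (history M x k)
                      (indicator {\<omega> \<in> space M. idx k \<omega> = j}) \<omega> = 1 / real r"
    and g_def:
      "\<And>k \<omega>. \<omega> \<in> space M \<Longrightarrow>
         g k \<omega> = (real r / real N) *\<^sub>R (\<Sum>j\<in>batch k \<omega> (idx k \<omega>). grad (f j) (x k \<omega>))"
    and y_def: "\<And>k \<omega>. \<omega> \<in> space M \<Longrightarrow> y k \<omega> = x k \<omega> - \<Delta> k \<omega> *\<^sub>R g k \<omega>"
    and res_bound:
      "\<And>k \<omega>. \<omega> \<in> space M \<Longrightarrow> norm (res k \<omega>) \<le> \<eta> k * norm (A *v x k \<omega> - b) + \<mu> k"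
    and x_step:
      "\<And>k \<omega>. \<omega> \<in> space M \<Longrightarrow> x (Suc k) \<omega> = inexact_proj A b (res k \<omega>) (y k \<omega>)"
    and \<Delta>_step:
      "\<And>k \<omega>. \<omega> \<in> space M \<Longrightarrow> \<Delta> (Suc k) \<omega> = \<alpha> (Suc k) * max \<delta>l (min (\<delta> k \<omega>) \<delta>u)"
    and \<Delta>_measurable: "\<And>k. \<Delta> k \<in> borel_measurable (history M x k)"

definition step_bound ::
  "'w measure \<Rightarrow> (nat \<Rightarrow> 'w \<Rightarrow> real^'n) \<Rightarrow> (nat \<Rightarrow> 'w \<Rightarrow> real) \<Rightarrow> (nat \<Rightarrow> real) \<Rightarrow>
   (real^'n \<Rightarrow> real^'n) \<Rightarrow> real \<Rightarrow> real \<Rightarrow> real \<Rightarrow> real \<Rightarrow> bool" where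
  "step_bound M x \<Delta> \<mu> d \<kappa>2 \<kappa>3 \<kappa>4 q \<longleftrightarrow>
     (\<forall>k. AE \<omega> in M.
        real_cond_exp M (history M x k) (\<lambda>\<omega>. (norm (x (Suc k) \<omega> - x k \<omega>))\<^sup>2) \<omega>
        \<le> \<kappa>2 * (\<Delta> k \<omega>)\<^sup>2 + \<kappa>3 * q ^ (2 * k) + \<kappa>4 * \<mu> k
          + 2 * (\<Delta> k \<omega>)\<^sup>2 * (norm (d (x k \<omega>)))\<^sup>2)"

end

theory Submission
  imports Defs
begin

text \<open>
  Let \<open>T = A\<^sup>T (A A\<^sup>T)\<^sup>-\<^sup>1\<close> and let \<open>P = I - T A\<close> be the orthogonal projector onto the kernel of \<open>A\<close>,
  so that \<open>P\<close> and \<open>T\<close> have orthogonal ranges. Then \<open>d(x) = - P \<nabla>f(x) - T (A x - b)\<close> and one step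
  of the method is \<open>x\<^sub>k\<^sub>+\<^sub>1 - x\<^sub>k = - \<Delta>\<^sub>k P g\<^sub>k - T (A x\<^sub>k - b + r\<^sub>k)\<close>, whence \<open>A x\<^sub>k\<^sub>+\<^sub>1 - b = - r\<^sub>k\<close>. The
  infeasibility is thus a contraction perturbed by \<open>\<mu>\<^sub>k\<close> and decays geometrically along every
  trajectory, so all contributions of \<open>T\<close> are summable. The descent lemma, together with
  \<open>E[P \<nabla>f(x\<^sub>k) \<bullet> g\<^sub>k | F\<^sub>k] = |P \<nabla>f(x\<^sub>k)|\<^sup>2\<close>, bounds the expected decrease of \<open>f\<close> from below by
  \<open>(\<alpha> \<delta>\<^sub>l / 2) E|d(x\<^sub>k)|\<^sup>2 - (L / 2) \<kappa>\<^sub>2 (\<alpha> \<delta>\<^sub>u)\<^sup>2\<close> up to a summable error, and telescoping gives the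
  claim. Every \<open>x\<^sub>k\<close> is a bounded random variable, because \<open>x\<^sub>0\<close> is deterministic and each step
  maps bounded sets to bounded sets; this settles all integrability questions.
\<close>

section \<open>Orthogonal splitting into the kernel and the row space of \<open>A\<close>\<close>

definition row_pinv :: "real^'n^'m \<Rightarrow> real^'m \<Rightarrow> real^'n" where
  "row_pinv A v = transpose A *v (matrix_inv (A ** transpose A) *v v)"

text \<open>\<open>null_proj A\<close> is the projector P and \<open>row_pinv A\<close> the map T of
  the overview. Under full row rank the latter is the Moore-Penrose inverse of
  \<open>A\<close>.\<close>

definition null_proj :: "real^'n^'m \<Rightarrow> real^'n \<Rightarrow> real^'n" where
  "null_proj A z = z - row_pinv A (A *v z)"

lemma linear_row_pinv: "linear (row_pinv A)"
proof -
  have "row_pinv A = (*v) (transpose A ** matrix_inv (A ** transpose A))"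
    by (simp add: row_pinv_def matrix_vector_mul_assoc fun_eq_iff)
  then show ?thesis
    by simp
qed

lemma linear_null_proj: "linear (null_proj A)"
  unfolding null_proj_def[abs_def]
  by (intro linear_compose_sub linear_ident)
     (rule linear_compose[OF matrix_vector_mul_linear linear_row_pinv, unfolded o_def])

lemma matrix_row_pinv:
  fixes A :: "real^'n^'m"
  assumes "rank A = CARD('m)"
  shows "A *v row_pinv A v = v"
proof -
  \<comment> \<open>\<open>matrix_inv\<close> is a choice term, so its defining equation is
    extracted from the invertibility of the Gram matrix, which full row rank provides.\<close>
  have "(A ** transpose A) ** matrix_inv (A ** transpose A) = mat 1"
    using invertible_gram[OF assms] unfolding invertible_def matrix_inv_def
    by (rule someI_ex[THEN conjunct1])
  then have "((A ** transpose A) ** matrix_inv (A ** transpose A)) *v v = v"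
    by simp
  then show ?thesis
    by (simp only: row_pinv_def matrix_vector_mul_assoc matrix_mul_assoc)
qed

text \<open>Since A T = I, the first vector lies in the kernel of \<open>A\<close>; the second lies
  in the range of its transpose, which is the orthogonal complement of that kernel.\<close>

lemma null_proj_orthogonal_row_pinv:
  fixes A :: "real^'n^'m"
  assumes "rank A = CARD('m)"
  shows "null_proj A z \<bullet> row_pinv A v = 0"
proof -
  have "A *v null_proj A z = 0"
    by (simp add: null_proj_def matrix_vector_mult_diff_distrib matrix_row_pinv[OF assms])
  then show ?thesis
    unfolding row_pinv_def
    by (metis dot_lmul_matrix inner_commute inner_zero_right transpose_matrix_vector)
qed

text \<open>Pythagoras for the splitting. The factor \<open>a\<close> will be the step size when a
  step is measured, and 1 when the projected gradient direction is.\<close>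

lemma norm_null_proj_row_pinv:
  fixes A :: "real^'n^'m"
  assumes "rank A = CARD('m)"
  shows "(norm (a *\<^sub>R null_proj A z + row_pinv A v))\<^sup>2
    = a\<^sup>2 * (norm (null_proj A z))\<^sup>2 + (norm (row_pinv A v))\<^sup>2"
  using norm_add_Pythagorean[of "a *\<^sub>R null_proj A z" "row_pinv A v"]
    null_proj_orthogonal_row_pinv[OF assms]
  by (simp add: orthogonal_def power_mult_distrib)

text \<open>The row-space part of \<open>u\<close> is orthogonal to the kernel. Used with both
  orders of the inner product, this shifts P from one factor to the other.\<close>

lemma inner_null_proj:
  fixes A :: "real^'n^'m"
  assumes "rank A = CARD('m)"
  shows "u \<bullet> null_proj A z = null_proj A u \<bullet> null_proj A z"
proof -
  have "u = null_proj A u + row_pinv A (A *v u)"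
    by (simp add: null_proj_def)
  then have "u \<bullet> null_proj A z
      = null_proj A u \<bullet> null_proj A z + row_pinv A (A *v u) \<bullet> null_proj A z"
    by (metis inner_add_left)
  then show ?thesis
    by (metis null_proj_orthogonal_row_pinv[OF assms] inner_commute add.right_neutral)
qed

lemma norm_null_proj_le:
  fixes A :: "real^'n^'m"
  assumes "rank A = CARD('m)"
  shows "norm (null_proj A z) \<le> norm z"
proof -
  have "(norm z)\<^sup>2 = (norm (null_proj A z))\<^sup>2 + (norm (row_pinv A (A *v z)))\<^sup>2"
    using norm_null_proj_row_pinv[OF assms, of 1 z "A *v z"] by (simp add: null_proj_def)
  then show ?thesis
    by (metis le_add_same_cancel1 norm_ge_zero power2_le_imp_le zero_le_power2)
qed

lemma inexact_proj_eq: "inexact_proj A b \<rho> z = z - row_pinv A (A *v z - b + \<rho>)"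
  by (simp only: inexact_proj_def row_pinv_def)

lemma proj_grad_dir_eq:
  "proj_grad_dir A b h z = - (null_proj A (grad h z) + row_pinv A (A *v z - b))"
proof -
  have "A *v (z - grad h z) - b = (A *v z - b) - A *v grad h z"
    by (simp add: matrix_vector_mult_diff_distrib)
  then have "row_pinv A (A *v (z - grad h z) - b) = row_pinv A (A *v z - b) - row_pinv A (A *v grad h z)"
    by (simp add: linear_diff[OF linear_row_pinv])
  then show ?thesis
    by (simp add: proj_grad_dir_def proj_def null_proj_def row_pinv_def)
qed

text \<open>Stationarity measure and tangential gradient differ only by an infeasibility term, which
  decays geometrically along a run; so one can be traded for the other.\<close>

lemma norm_proj_grad_dir:
  fixes A :: "real^'n^'m"
  assumes "rank A = CARD('m)"
  shows "(norm (proj_grad_dir A b h z))\<^sup>2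
    = (norm (null_proj A (grad h z)))\<^sup>2 + (norm (row_pinv A (A *v z - b)))\<^sup>2"
  using norm_null_proj_row_pinv[OF assms, of 1 "grad h z" "A *v z - b"]
  unfolding proj_grad_dir_eq norm_minus_cancel by simp

lemma continuous_on_null_proj:
  assumes "continuous_on S h"
  shows "continuous_on S (\<lambda>z. null_proj A (h z))"
  by (rule continuous_on_compose2[OF linear_continuous_on[of "null_proj A" UNIV] assms])
     (auto simp: linear_null_proj linear_conv_bounded_linear[symmetric])

lemma continuous_proj_grad_dir:
  assumes "continuous_on UNIV (grad h)"
  shows "continuous_on UNIV (proj_grad_dir A b h)"
proof -
  have "continuous_on UNIV (\<lambda>z. null_proj A (grad h z))"
    by (rule continuous_on_null_proj[OF assms])
  moreover have "continuous_on UNIV (\<lambda>z. row_pinv A (A *v z - b))"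
    by (rule continuous_on_compose2[OF linear_continuous_on[of "row_pinv A" UNIV]])
       (auto simp: linear_row_pinv linear_conv_bounded_linear[symmetric]
         intro!: continuous_intros matrix_vector_mult_linear_continuous_on)
  ultimately show ?thesis
    unfolding proj_grad_dir_eq[abs_def] by (intro continuous_intros)
qed

section \<open>Gradients and the descent lemma\<close>

lemma GDERIV_imp_grad_eq:
  assumes "GDERIV h z :> D"
  shows "grad h z = D"
proof -
  have "h differentiable (at z)"
    using assms unfolding gderiv_def differentiable_def by blast
  then have "GDERIV h z :> grad h z"
    by (rule GDERIV_grad)
  then have "(\<lambda>v. v \<bullet> grad h z) = (\<lambda>v. v \<bullet> D)"
    using assms has_derivative_unique unfolding gderiv_def by blast
  then show ?thesis
    by (metis vector_eq_ldot)
qed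

lemma grad_avg_fun:
  assumes "\<And>i. i \<in> {1..N} \<Longrightarrow> f i differentiable (at z)"
  shows "grad (avg_fun N f) z = (1 / real N) *\<^sub>R (\<Sum>i=1..N. grad (f i) z)"
proof (rule GDERIV_imp_grad_eq)
  have "((\<lambda>w. \<Sum>i=1..N. f i w) has_derivative (\<lambda>v. \<Sum>i=1..N. v \<bullet> grad (f i) z)) (at z)"
    using GDERIV_grad[OF assms] unfolding gderiv_def by (intro has_derivative_sum) auto
  from has_derivative_mult_right[OF this, of "1 / real N"]
  show "GDERIV (avg_fun N f) z :> (1 / real N) *\<^sub>R (\<Sum>i=1..N. grad (f i) z)"
    unfolding gderiv_def avg_fun_def[abs_def] by (simp add: inner_sum_right)
qed

text \<open>Along the segment from \<open>z\<close> to \<open>w\<close>, the function minus its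
  quadratic majorant is nonincreasing: by Cauchy-Schwarz and the Lipschitz bound its derivative is
  at most 0. Comparing the endpoints of \<open>[0, 1]\<close> gives the claim without integrating
  the gradient.\<close>

lemma lipschitz_grad_descent:
  assumes diff: "\<And>z. h differentiable (at z)" and lip: "L-lipschitz_on UNIV (grad h)"
  shows "h w \<le> h z + grad h z \<bullet> (w - z) + L / 2 * (norm (w - z))\<^sup>2"
proof -
  define v where "v = w - z"
  define \<phi> where "\<phi> t = h (z + t *\<^sub>R v) - t * (grad h z \<bullet> v) - L / 2 * t\<^sup>2 * (norm v)\<^sup>2" for t
  have "\<phi> 1 \<le> \<phi> 0"
  proof (rule DERIV_nonpos_imp_nonincreasing[of 0 1 \<phi>])
    fix t :: real assume t: "0 \<le> t" "t \<le> 1"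
    have "(h has_derivative (\<lambda>u. u \<bullet> grad h (z + t *\<^sub>R v))) (at (z + t *\<^sub>R v))"
      using GDERIV_grad[OF diff] unfolding gderiv_def .
    moreover have "((\<lambda>t. z + t *\<^sub>R v) has_derivative (\<lambda>s. s *\<^sub>R v)) (at t)"
      by (auto intro!: derivative_eq_intros)
    ultimately have "((\<lambda>t. h (z + t *\<^sub>R v)) has_derivative (\<lambda>s. (s *\<^sub>R v) \<bullet> grad h (z + t *\<^sub>R v))) (at t)"
      by (rule has_derivative_compose[rotated])
    then have "((\<lambda>t. h (z + t *\<^sub>R v)) has_real_derivative v \<bullet> grad h (z + t *\<^sub>R v)) (at t)"
      by (simp add: has_field_derivative_def mult_commute_abs)
    then have "(\<phi> has_real_derivative
        v \<bullet> grad h (z + t *\<^sub>R v) - grad h z \<bullet> v - L * t * (norm v)\<^sup>2) (at t)"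
      unfolding \<phi>_def by (auto intro!: derivative_eq_intros)
    moreover have "v \<bullet> grad h (z + t *\<^sub>R v) - grad h z \<bullet> v - L * t * (norm v)\<^sup>2 \<le> 0"
    proof -
      have "v \<bullet> grad h (z + t *\<^sub>R v) - grad h z \<bullet> v = v \<bullet> (grad h (z + t *\<^sub>R v) - grad h z)"
        by (simp add: inner_diff_right inner_commute)
      also have "\<dots> \<le> norm v * norm (grad h (z + t *\<^sub>R v) - grad h z)"
        by (rule norm_cauchy_schwarz)
      also have "\<dots> \<le> norm v * (L * norm (t *\<^sub>R v))"
        using lipschitz_onD[OF lip, of "z + t *\<^sub>R v" z]
        by (intro mult_left_mono) (auto simp: dist_norm)
      also have "\<dots> = L * t * (norm v)\<^sup>2"
        using t by (simp add: power2_eq_square)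
      finally show ?thesis by simp
    qed
    ultimately show "\<exists>y. (\<phi> has_real_derivative y) (at t) \<and> y \<le> 0"
      by blast
  qed simp
  then show ?thesis
    by (simp add: \<phi>_def v_def)
qed

section \<open>Real sequences: perturbed contraction and averaged descent\<close>

lemma perturbed_contraction_geometric:
  fixes e :: "nat \<Rightarrow> real"
  assumes step: "\<And>k. e (Suc k) \<le> \<eta> * e k + C * q ^ k"
    and "0 \<le> \<eta>" "\<eta> < q" "e 0 \<le> D" "C \<le> D * (q - \<eta>)"
  shows "e k \<le> D * q ^ k"
proof (induction k)
  case 0
  then show ?case using assms by simp
next
  case (Suc k)
  \<comment> \<open>The condition on \<open>C\<close> lets the perturbation fill exactly the gap
    between the contraction rate \<open>\<eta>\<close> and the slower rate \<open>q\<close>.\<close>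
  have "e (Suc k) \<le> \<eta> * (D * q ^ k) + (D * (q - \<eta>)) * q ^ k"
    using assms Suc
    by (intro order.trans[OF step] add_mono mult_left_mono mult_right_mono) auto
  also have "\<dots> = D * q ^ Suc k"
    by (simp add: algebra_simps)
  finally show ?case .
qed

text \<open>Telescoping bounds \<open>c\<close> times the partial sums of \<open>u\<close> by a
  constant plus \<open>K * v\<close>. After division by \<open>K\<close> the constant (initial gap
  plus total error) vanishes in the limit and only \<open>v / c\<close> survives.\<close>

lemma limsup_average_le_of_perturbed_descent:
  fixes a u \<epsilon> :: "nat \<Rightarrow> real"
  assumes descent: "\<And>k. a (Suc k) \<le> a k - c * u k + v + \<epsilon> k"
    and below: "\<And>k. l \<le> a k" and "0 < c" and eps: "summable \<epsilon>" "\<And>k. 0 \<le> \<epsilon> k"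
  shows "limsup (\<lambda>K. ereal ((1 / real K) * (\<Sum>k=0..K. u k))) \<le> ereal (v / c)"
proof -
  define S where "S = (a 0 - l + suminf \<epsilon>) / c"
  have "c * (\<Sum>k<K. u k) \<le> a 0 - a K + real K * v + (\<Sum>k<K. \<epsilon> k)" for K
  proof (induction K)
    case (Suc K)
    then show ?case using descent[of K] by (simp add: algebra_simps)
  qed simp
  moreover have "(\<Sum>k<K. \<epsilon> k) \<le> suminf \<epsilon>" for K
    using eps by (intro sum_le_suminf) auto
  ultimately have "c * (\<Sum>k<K. u k) \<le> a 0 - l + real K * v + suminf \<epsilon>" for K
    using below[of K] by (meson add_mono diff_left_mono order.refl order.trans add_right_mono)
  then have "(\<Sum>k<K. u k) \<le> (a 0 - l + real K * v + suminf \<epsilon>) / c" for K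
    using \<open>0 < c\<close> by (metis pos_le_divide_eq mult.commute)
  \<comment> \<open>The average divides the \<open>Suc K\<close> terms with indices 0 to
    \<open>K\<close> by \<open>K\<close>; the surplus term costs a factor
    \<open>1 + 1 / real K\<close>, which tends to 1.\<close>
  from this[of "Suc _"] have bound: "(\<Sum>k=0..K. u k) \<le> S + real (Suc K) * (v / c)" for K
    by (simp only: S_def atLeast0AtMost lessThan_Suc_atMost add_divide_distrib times_divide_eq_right
        add.assoc add.commute[of "suminf \<epsilon> / c"])
  have "limsup (\<lambda>K. ereal ((1 / real K) * (\<Sum>k=0..K. u k)))
      \<le> limsup (\<lambda>K. ereal (S / real K + (1 + 1 / real K) * (v / c)))"
  \<comment> \<open>The index 0 is skipped, where \<open>1 / real K\<close> takes the default value
    0.\<close>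
  proof (rule Limsup_mono, rule eventually_sequentiallyI[of 1])
    fix K :: nat assume "1 \<le> K"
    then have "(1 / real K) * (S + real (Suc K) * (v / c)) = S / real K + (1 + 1 / real K) * (v / c)"
      by (simp add: divide_simps)
    then show "ereal ((1 / real K) * (\<Sum>k=0..K. u k)) \<le> ereal (S / real K + (1 + 1 / real K) * (v / c))"
      using mult_left_mono[OF bound[of K], of "1 / real K"] by simp
  qed
  also have "(\<lambda>K. S / real K + (1 + 1 / real K) * (v / c)) \<longlonglongrightarrow> 0 + (1 + 0) * (v / c)"
    by (intro tendsto_intros lim_const_over_n)
  then have "limsup (\<lambda>K. ereal (S / real K + (1 + 1 / real K) * (v / c))) = ereal (v / c)"
    by (intro lim_imp_Limsup) auto
  finally show ?thesis .
qed

lemma R_linear_to_zero_summable: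
  assumes "R_linear_to_zero u" "\<And>k. 0 \<le> u k"
  shows "summable u"
proof -
  obtain C \<rho> where \<rho>: "0 < \<rho>" "\<rho> < 1" "\<And>k. u k \<le> C * \<rho> ^ k"
    using assms(1) unfolding R_linear_to_zero_def by blast
  have "summable (\<lambda>k. C * \<rho> ^ k)"
    using \<rho> by (intro summable_mult summable_geometric) simp
  then show ?thesis
    by (rule summable_comparison_test'[where N = 0]) (use \<rho>(3) assms(2) in simp)
qed

section \<open>Identities and decay of infeasibility along a single trajectory\<close>

context psg_leco
begin

lemma idx_in_range: "\<omega> \<in> space M \<Longrightarrow> idx k \<omega> \<in> {1..r}"
  using measurable_space[OF idx_random] by simp

text \<open>A probability space has a point, and the index sampled there lies in
  \<open>{1..r}\<close>.\<close>

lemma r_pos: "0 < r"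
proof -
  obtain \<omega> where "\<omega> \<in> space M"
    using not_empty by blast
  then show ?thesis
    using idx_in_range[of \<omega> 0] by simp
qed

lemma batch_subset: "\<omega> \<in> space M \<Longrightarrow> j \<in> {1..r} \<Longrightarrow> batch k \<omega> j \<subseteq> {1..N}"
  using batch_partition[of \<omega> k] partition_onD1 by fastforce

lemma sum_batches:
  assumes "\<omega> \<in> space M"
  shows "(\<Sum>j=1..r. \<Sum>i\<in>batch k \<omega> j. h i) = (\<Sum>i=1..N. h i)"
proof -
  note part = batch_partition[OF assms, of k]
  have "disjoint (batch k \<omega> ` {1..r})"
    using part partition_onD2 by blast
  \<comment> \<open>A partition separates distinct blocks; injectivity of the enumeration turns this
    into separation of distinct indices.\<close>
  then have disj: "batch k \<omega> i \<inter> batch k \<omega> j = {}" if "i \<in> {1..r}" "j \<in> {1..r}" "i \<noteq> j" for i j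
    using that part inj_onD[of "batch k \<omega>" "{1..r}" i j] unfolding disjoint_def by blast
  have "(\<Sum>i=1..N. h i) = (\<Sum>i\<in>(\<Union>j\<in>{1..r}. batch k \<omega> j). h i)"
    using part partition_onD1 by metis
  also have "\<dots> = (\<Sum>j=1..r. \<Sum>i\<in>batch k \<omega> j. h i)"
    using disj finite_subset[OF batch_subset[OF assms]] by (intro sum.UNION_disjoint) auto
  finally show ?thesis ..
qed

lemma \<Delta>_bounds:
  assumes "\<omega> \<in> space M"
  shows "\<alpha> k * \<delta>l \<le> \<Delta> k \<omega>" "\<Delta> k \<omega> \<le> \<alpha> k * \<delta>u"
proof -
  have "\<alpha> k * \<delta>l \<le> \<Delta> k \<omega> \<and> \<Delta> k \<omega> \<le> \<alpha> k * \<delta>u"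
  proof (cases k)
    case 0
    then show ?thesis
      using \<Delta>0_bounds \<Delta>_init[OF assms] by simp
  next
    case (Suc j)
    then show ?thesis
      using \<alpha>_pos[of k] \<delta>_bounds \<Delta>_step[OF assms, of j] by (auto intro!: mult_left_mono)
  qed
  then show "\<alpha> k * \<delta>l \<le> \<Delta> k \<omega>" "\<Delta> k \<omega> \<le> \<alpha> k * \<delta>u"
    by auto
qed

lemma \<Delta>_pos: "\<omega> \<in> space M \<Longrightarrow> 0 < \<Delta> k \<omega>"
  using \<Delta>_bounds(1)[of \<omega> k] \<alpha>_pos[of k] \<delta>_bounds by (smt (verit) mult_pos_pos)

lemma step_eq:
  assumes "\<omega> \<in> space M"
  shows "x (Suc k) \<omega> - x k \<omega>
    = - (\<Delta> k \<omega> *\<^sub>R null_proj A (g k \<omega>) + row_pinv A (A *v x k \<omega> - b + res k \<omega>))"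
proof -
  let ?T = "row_pinv A"
  have "A *v y k \<omega> - b + res k \<omega> = (A *v x k \<omega> - b + res k \<omega>) - \<Delta> k \<omega> *\<^sub>R (A *v g k \<omega>)"
    by (simp add: y_def[OF assms] matrix_vector_mult_diff_distrib matrix_vector_mult_scaleR)
  then have "?T (A *v y k \<omega> - b + res k \<omega>)
      = ?T (A *v x k \<omega> - b + res k \<omega>) - \<Delta> k \<omega> *\<^sub>R ?T (A *v g k \<omega>)"
    by (simp only: linear_diff[OF linear_row_pinv] linear_cmul[OF linear_row_pinv])
  then show ?thesis
    unfolding x_step[OF assms] inexact_proj_eq
    by (simp add: y_def[OF assms] null_proj_def scaleR_diff_right)
qed

text \<open>By A T = I the correction cancels \<open>A *v y k \<omega> - b\<close> entirely and
  leaves the residual. The residual bound thereby becomes a recursion for the infeasibility.\<close>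

lemma infeasibility_step:
  assumes "\<omega> \<in> space M"
  shows "A *v x (Suc k) \<omega> - b = - res k \<omega>"
proof -
  have "x (Suc k) \<omega> = y k \<omega> - row_pinv A (A *v y k \<omega> - b + res k \<omega>)"
    using x_step[OF assms, of k] by (simp only: inexact_proj_eq)
  then show ?thesis
    by (simp add: matrix_vector_mult_diff_distrib matrix_row_pinv[OF full_row_rank])
qed

lemma infeasibility_geometric:
  assumes eta: "\<And>k. \<eta> k \<le> \<eta>'" "\<eta>' < q" and mu: "\<And>k. \<mu> k \<le> C * q ^ k"
  obtains D where "0 < D" "\<And>k \<omega>. \<omega> \<in> space M \<Longrightarrow> norm (A *v x k \<omega> - b) \<le> D * q ^ k"
proof
  \<comment> \<open>The first summand covers the initial infeasibility, the second the perturbation,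
    and the 1 keeps the constant positive. As the start is deterministic, it serves all trajectories
    at once.\<close>
  let ?D = "norm (A *v x0 - b) + \<bar>C\<bar> / (q - \<eta>') + 1"
  show "0 < ?D"
    using eta(2) by (intro add_nonneg_pos add_nonneg_nonneg) auto
  fix k \<omega> assume \<omega>: "\<omega> \<in> space M"
  show "norm (A *v x k \<omega> - b) \<le> ?D * q ^ k"
  proof (rule perturbed_contraction_geometric[where \<eta> = \<eta>' and C = C])
    show "norm (A *v x (Suc k) \<omega> - b) \<le> \<eta>' * norm (A *v x k \<omega> - b) + C * q ^ k" for k
      unfolding infeasibility_step[OF \<omega>] norm_minus_cancel
      by (intro order.trans[OF res_bound[OF \<omega>]] add_mono mult_right_mono eta mu) simp
    show "0 \<le> \<eta>'"
      using \<eta>_nonneg[of 0] eta(1)[of 0] by simp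
    show "norm (A *v x 0 \<omega> - b) \<le> ?D"
      using eta(2) x_init[OF \<omega>] by simp
    show "C \<le> ?D * (q - \<eta>')"
      using eta(2) by (simp add: distrib_right)
        (smt (verit) mult_nonneg_nonneg norm_ge_zero)
  qed (rule eta(2))
qed

section \<open>Boundedness of gradients and iterates at each fixed iteration\<close>

lemma continuous_image_bounded:
  fixes h :: "real^'n \<Rightarrow> 'b::real_normed_vector"
  assumes "continuous_on UNIV h" "\<And>\<omega>. \<omega> \<in> space M \<Longrightarrow> norm (x k \<omega>) \<le> R"
  shows "\<exists>B. \<forall>\<omega>\<in>space M. norm (h (x k \<omega>)) \<le> B"
proof -
  have "compact (h ` cball 0 R)"
    using assms(1) by (intro compact_continuous_image) (auto intro: continuous_on_subset)
  then obtain B where "\<forall>z\<in>h ` cball 0 R. norm z \<le> B"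
    using compact_imp_bounded bounded_iff by metis
  then show ?thesis
    using assms(2) by (intro exI[of _ B]) auto
qed

text \<open>Adding the bounds of all \<open>N\<close> components makes the constant independent of
  which components the random batch contains.\<close>

lemma batch_gradient_bounded:
  assumes "\<And>\<omega>. \<omega> \<in> space M \<Longrightarrow> norm (x k \<omega>) \<le> R"
  shows "\<exists>B. \<forall>j\<in>{1..r}. \<forall>\<omega>\<in>space M. norm (\<Sum>i\<in>batch k \<omega> j. grad (f i) (x k \<omega>)) \<le> B"
proof -
  have "\<forall>i\<in>{1..N}. \<exists>B. \<forall>\<omega>\<in>space M. norm (grad (f i) (x k \<omega>)) \<le> B"
    using f_cont_diff continuous_image_bounded[OF _ assms] unfolding cont_diff_def by blast
  then obtain B where B: "\<And>i \<omega>. i \<in> {1..N} \<Longrightarrow> \<omega> \<in> space M \<Longrightarrow> norm (grad (f i) (x k \<omega>)) \<le> B i"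
    by metis
  have "norm (\<Sum>i\<in>batch k \<omega> j. grad (f i) (x k \<omega>)) \<le> (\<Sum>i=1..N. B i)"
    if "j \<in> {1..r}" "\<omega> \<in> space M" for j \<omega>
  proof -
    have "norm (\<Sum>i\<in>batch k \<omega> j. grad (f i) (x k \<omega>)) \<le> (\<Sum>i\<in>batch k \<omega> j. norm (grad (f i) (x k \<omega>)))"
      by (rule norm_sum)
    also have "\<dots> \<le> (\<Sum>i=1..N. norm (grad (f i) (x k \<omega>)))"
      using batch_subset that by (intro sum_mono2) auto
    also have "\<dots> \<le> (\<Sum>i=1..N. B i)"
      using B that by (intro sum_mono) auto
    finally show ?thesis .
  qed
  then show ?thesis by blast
qed

lemma sampled_gradient_bounded:
  assumes "\<And>\<omega>. \<omega> \<in> space M \<Longrightarrow> norm (x k \<omega>) \<le> R"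
  shows "\<exists>B. \<forall>\<omega>\<in>space M. norm (g k \<omega>) \<le> B"
proof -
  obtain B where B: "\<And>j \<omega>. j \<in> {1..r} \<Longrightarrow> \<omega> \<in> space M \<Longrightarrow>
      norm (\<Sum>i\<in>batch k \<omega> j. grad (f i) (x k \<omega>)) \<le> B"
    using batch_gradient_bounded[OF assms] by blast
  have "norm (g k \<omega>) \<le> real r / real N * B" if \<omega>: "\<omega> \<in> space M" for \<omega>
    unfolding g_def[OF \<omega>] norm_scaleR
    using B[OF idx_in_range[OF \<omega>] \<omega>] by (simp add: mult_left_mono divide_right_mono)
  then show ?thesis by blast
qed

text \<open>The bound may grow with \<open>k\<close>; it serves integrability only. In the induction
  step a bounded iterate yields a bounded sampled gradient and a bounded residual, hence a bounded
  increment.\<close>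

lemma iterate_bounded: "\<exists>R. \<forall>\<omega>\<in>space M. norm (x k \<omega>) \<le> R"
proof (induction k)
  case 0
  then show ?case
    using x_init by (intro exI[of _ "norm x0"]) simp
next
  case (Suc k)
  then obtain R where R: "\<And>\<omega>. \<omega> \<in> space M \<Longrightarrow> norm (x k \<omega>) \<le> R"
    by blast
  obtain G where G: "\<And>\<omega>. \<omega> \<in> space M \<Longrightarrow> norm (g k \<omega>) \<le> G"
    using sampled_gradient_bounded[OF R] by blast
  have "continuous_on UNIV (\<lambda>z. A *v z - b)"
    by (intro continuous_intros matrix_vector_mult_linear_continuous_on)
  then obtain E where E: "\<And>\<omega>. \<omega> \<in> space M \<Longrightarrow> norm (A *v x k \<omega> - b) \<le> E"
    using continuous_image_bounded[OF _ R] by blast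
  obtain c where c: "c > 0" "\<And>v. norm (row_pinv A v) \<le> c * norm v"
    using linear_bounded_pos[OF linear_row_pinv] by blast
  have "norm (x (Suc k) \<omega>) \<le> R + (\<alpha> k * \<delta>u * G + c * (E + (\<eta> k * E + \<mu> k)))"
    if \<omega>: "\<omega> \<in> space M" for \<omega>
  proof -
    have "norm (row_pinv A (A *v x k \<omega> - b + res k \<omega>)) \<le> c * (E + (\<eta> k * E + \<mu> k))"
      using c(1) E[OF \<omega>] \<eta>_nonneg[of k]
      by (intro order.trans[OF c(2)] mult_left_mono order.trans[OF norm_triangle_ineq] add_mono
          order.trans[OF res_bound[OF \<omega>]]) auto
    moreover have "norm (\<Delta> k \<omega> *\<^sub>R null_proj A (g k \<omega>)) \<le> \<alpha> k * \<delta>u * G"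
      unfolding norm_scaleR using \<Delta>_pos[OF \<omega>, of k] \<Delta>_bounds(2)[OF \<omega>, of k]
      by (intro mult_mono order.trans[OF norm_null_proj_le[OF full_row_rank] G[OF \<omega>]]) auto
    ultimately have "norm (x (Suc k) \<omega> - x k \<omega>) \<le> \<alpha> k * \<delta>u * G + c * (E + (\<eta> k * E + \<mu> k))"
      unfolding step_eq[OF \<omega>] norm_minus_cancel by (intro norm_triangle_mono)
    then show ?thesis
      using R[OF \<omega>] norm_triangle_sub[of "x (Suc k) \<omega>" "x k \<omega>"] by linarith
  qed
  then show ?case by blast
qed

lemma continuous_iterate_bounded:
  fixes h :: "real^'n \<Rightarrow> 'b::real_normed_vector"
  assumes "continuous_on UNIV h"
  obtains B where "\<And>\<omega>. \<omega> \<in> space M \<Longrightarrow> norm (h (x k \<omega>)) \<le> B"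
  using continuous_image_bounded[OF assms] iterate_bounded by metis

section \<open>The filtration and unbiasedness of the sampled gradient\<close>

lemma subalgebra_history: "subalgebra M (history M x k)"
  unfolding subalgebra_def history_def
  using x_random by (auto simp: space_measure_of_conv sets_measure_of_conv
      intro!: sets.sigma_sets_subset measurable_sets)

sublocale history: finite_measure_subalgebra M "history M x k" for k
  by unfold_locales (rule subalgebra_history)

lemma space_history: "space (history M x k) = space M"
  using subalgebra_history unfolding subalgebra_def by blast

lemma iterate_measurable_history: "x k \<in> borel_measurable (history M x k)"
proof (rule measurableI)
  show "x k -` B \<inter> space (history M x k) \<in> sets (history M x k)" if "B \<in> sets borel" for B
    unfolding space_history using that unfolding history_def
    by (intro in_measure_of) auto
qed simp

lemma continuous_iterate_measurable_history:
  assumes "continuous_on UNIV h"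
  shows "(\<lambda>\<omega>. h (x k \<omega>)) \<in> borel_measurable (history M x k)"
  by (rule borel_measurable_continuous_on[OF assms iterate_measurable_history])

text \<open>Batches are random sets. Rewriting a batch sum as a sum over the fixed set
  \<open>{1..N}\<close> with membership tests reduces its measurability to this case.\<close>

lemma measurable_if_batch:
  assumes "j \<in> {1..r}" "h \<in> borel_measurable (history M x k)"
  shows "(\<lambda>\<omega>. if i \<in> batch k \<omega> j then h \<omega> else 0) \<in> borel_measurable (history M x k)"
proof -
  have "Measurable.pred (history M x k) (\<lambda>\<omega>. i \<in> batch k \<omega> j)"
    by (rule measurable_compose[OF batch_measurable[OF assms(1)]]) simp
  then show ?thesis
    using assms(2) by (intro measurable_If_set measurable_If) auto
qed

lemma sum_batch_eq:
  assumes "\<omega> \<in> space M" "j \<in> {1..r}"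
  shows "(\<Sum>i\<in>batch k \<omega> j. h i) = (\<Sum>i=1..N. if i \<in> batch k \<omega> j then h i else 0)"
  using batch_subset[OF assms] by (simp add: sum.If_cases Int_absorb1)

lemma batch_gradient_measurable_history:
  assumes "j \<in> {1..r}"
  shows "(\<lambda>\<omega>. \<Sum>i\<in>batch k \<omega> j. grad (f i) (x k \<omega>)) \<in> borel_measurable (history M x k)"
proof -
  have "(\<lambda>\<omega>. \<Sum>i=1..N. if i \<in> batch k \<omega> j then grad (f i) (x k \<omega>) else 0)
      \<in> borel_measurable (history M x k)"
    using f_cont_diff unfolding cont_diff_def
    by (intro borel_measurable_sum measurable_if_batch continuous_iterate_measurable_history assms) auto
  then show ?thesis
  proof (rule measurable_cong[THEN iffD2, rotated])
    show "(\<Sum>i\<in>batch k \<omega> j. grad (f i) (x k \<omega>))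
        = (\<Sum>i=1..N. if i \<in> batch k \<omega> j then grad (f i) (x k \<omega>) else 0)"
      if "\<omega> \<in> space (history M x k)" for \<omega>
      using that assms by (intro sum_batch_eq) (simp_all only: space_history)
  qed
qed

text \<open>Separates the fresh randomness, carried by the indicators of the drawn index, from the
  batch gradients, which are determined by the history.\<close>

lemma sampled_gradient_eq_sum:
  assumes "\<omega> \<in> space M"
  shows "g k \<omega> = (real r / real N) *\<^sub>R
    (\<Sum>j=1..r. indicat_real {\<omega>\<in>space M. idx k \<omega> = j} \<omega> *\<^sub>R (\<Sum>i\<in>batch k \<omega> j. grad (f i) (x k \<omega>)))"
proof -
  have "(\<Sum>j=1..r. indicat_real {\<omega>\<in>space M. idx k \<omega> = j} \<omega> *\<^sub>R (\<Sum>i\<in>batch k \<omega> j. grad (f i) (x k \<omega>)))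
      = (\<Sum>j=1..r. if j = idx k \<omega> then (\<Sum>i\<in>batch k \<omega> j. grad (f i) (x k \<omega>)) else 0)"
    using assms by (intro sum.cong) (auto simp: indicator_def)
  also have "\<dots> = (\<Sum>i\<in>batch k \<omega> (idx k \<omega>). grad (f i) (x k \<omega>))"
    using idx_in_range[OF assms, of k] by simp
  finally show ?thesis
    using g_def[OF assms] by simp
qed

lemma idx_event_measurable: "{\<omega>\<in>space M. idx k \<omega> = j} \<in> sets M"
proof -
  \<comment> \<open>Measurability of the index concerns subsets of \<open>{1..r}\<close> only; for
    \<open>j\<close> outside that range the event is empty.\<close>
  have "idx k -` ({j} \<inter> {1..r}) \<inter> space M \<in> sets M"
    by (rule measurable_sets[OF idx_random]) simp
  also have "idx k -` ({j} \<inter> {1..r}) \<inter> space M = {\<omega>\<in>space M. idx k \<omega> = j}"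
    using idx_in_range by fastforce
  finally show ?thesis .
qed

lemma sampled_gradient_measurable: "g k \<in> borel_measurable M"
proof -
  have "(\<lambda>\<omega>. (real r / real N) *\<^sub>R (\<Sum>j=1..r. indicat_real {\<omega>\<in>space M. idx k \<omega> = j} \<omega> *\<^sub>R
      (\<Sum>i\<in>batch k \<omega> j. grad (f i) (x k \<omega>)))) \<in> borel_measurable M"
    using measurable_from_subalg[OF subalgebra_history batch_gradient_measurable_history]
    by (intro borel_measurable_scaleR borel_measurable_sum borel_measurable_const
        borel_measurable_indicator idx_event_measurable) auto
  then show ?thesis
    by (subst measurable_cong[OF sampled_gradient_eq_sum])
qed

lemma grad_average:
  "grad (avg_fun N f) z = (1 / real N) *\<^sub>R (\<Sum>i=1..N. grad (f i) z)"
  using f_cont_diff by (intro grad_avg_fun) (auto simp: cont_diff_def)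

text \<open>The conditional mean of \<open>g k\<close>, in weak form: it is tested against bounded
  history-measurable vectors. This needs conditional expectations of real indicators only.\<close>

lemma sampled_gradient_unbiased:
  assumes h: "h \<in> borel_measurable (history M x k)"
    and B: "\<And>\<omega>. \<omega> \<in> space M \<Longrightarrow> norm (h \<omega>) \<le> B"
  shows "(\<integral>\<omega>. h \<omega> \<bullet> g k \<omega> \<partial>M) = (\<integral>\<omega>. h \<omega> \<bullet> grad (avg_fun N f) (x k \<omega>) \<partial>M)"
proof -
  define H where "H j \<omega> = h \<omega> \<bullet> (\<Sum>i\<in>batch k \<omega> j. grad (f i) (x k \<omega>))" for j \<omega>
  define J where "J j = indicat_real {\<omega>\<in>space M. idx k \<omega> = j}" for j
  have H: "H j \<in> borel_measurable (history M x k)" if "j \<in> {1..r}" for j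
    unfolding H_def using h batch_gradient_measurable_history[OF that]
    by (intro borel_measurable_inner) auto
  have J: "J j \<in> borel_measurable M" for j
    unfolding J_def by (intro borel_measurable_indicator idx_event_measurable)
  obtain C where C: "\<And>j \<omega>. j \<in> {1..r} \<Longrightarrow> \<omega> \<in> space M \<Longrightarrow>
      norm (\<Sum>i\<in>batch k \<omega> j. grad (f i) (x k \<omega>)) \<le> C"
    using batch_gradient_bounded[of k] iterate_bounded[of k] by blast
  have Hbound: "norm (H j \<omega>) \<le> B * C" if "j \<in> {1..r}" "\<omega> \<in> space M" for j \<omega>
    unfolding H_def real_norm_def using B[OF that(2)] C[OF that]
    by (intro order.trans[OF Cauchy_Schwarz_ineq2] mult_mono) (auto intro: order.trans[OF norm_ge_zero])
  have intH: "integrable M (H j)" if "j \<in> {1..r}" for j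
    using Hbound that measurable_from_subalg[OF subalgebra_history H[OF that]]
    by (intro integrable_const_bound[of _ "B * C"]) auto
  have intHJ: "integrable M (\<lambda>\<omega>. H j \<omega> * J j \<omega>)" if "j \<in> {1..r}" for j
    unfolding J_def using intH[OF that] idx_event_measurable
    by (rule integrable_real_mult_indicator[rotated])
  \<comment> \<open>\<open>H j\<close> is history-measurable, so under the integral the indicator
    may be replaced by its conditional expectation \<open>1 / real r\<close>.\<close>
  have mean: "(\<integral>\<omega>. H j \<omega> * J j \<omega> \<partial>M) = (1 / real r) * (\<integral>\<omega>. H j \<omega> \<partial>M)" if "j \<in> {1..r}" for j
  proof -
    have "(\<integral>\<omega>. H j \<omega> * J j \<omega> \<partial>M) = (\<integral>\<omega>. H j \<omega> * real_cond_exp M (history M x k) (J j) \<omega> \<partial>M)"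
      by (rule history.real_cond_exp_intg(2)[symmetric, OF intHJ[OF that] H[OF that] J])
    also have "\<dots> = (\<integral>\<omega>. (1 / real r) * H j \<omega> \<partial>M)"
    proof (rule integral_cong_AE)
      show "AE \<omega> in M. H j \<omega> * real_cond_exp M (history M x k) (J j) \<omega> = (1 / real r) * H j \<omega>"
        using idx_uniform[OF that, of k] unfolding J_def by eventually_elim simp
    qed (use measurable_from_subalg[OF subalgebra_history H[OF that]] in auto)
    finally show ?thesis by simp
  qed
  have "(\<integral>\<omega>. h \<omega> \<bullet> g k \<omega> \<partial>M) = (\<integral>\<omega>. (real r / real N) * (\<Sum>j=1..r. H j \<omega> * J j \<omega>) \<partial>M)"
    by (intro Bochner_Integration.integral_cong)
       (auto simp: sampled_gradient_eq_sum H_def J_def inner_sum_right mult.commute)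
  also have "\<dots> = (real r / real N) * (\<Sum>j=1..r. \<integral>\<omega>. H j \<omega> * J j \<omega> \<partial>M)"
    using intHJ by simp
  \<comment> \<open>The scaling by \<open>r\<close> in the definition of \<open>g k\<close> cancels
    the sampling probability.\<close>
  also have "\<dots> = (1 / real N) * (\<Sum>j=1..r. \<integral>\<omega>. H j \<omega> \<partial>M)"
    using r_pos by (simp add: mean flip: sum_divide_distrib)
  also have "\<dots> = (\<integral>\<omega>. (1 / real N) * (\<Sum>j=1..r. H j \<omega>) \<partial>M)"
    using intH by simp
  also have "\<dots> = (\<integral>\<omega>. h \<omega> \<bullet> grad (avg_fun N f) (x k \<omega>) \<partial>M)"
    by (intro Bochner_Integration.integral_cong)
       (simp_all add: H_def grad_average sum_batches[unfolded One_nat_def] flip: inner_sum_right)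
  finally show ?thesis .
qed

section \<open>Integrability\<close>

lemma bounded_norm_power2_integrable:
  fixes Z :: "'w \<Rightarrow> 'b::{banach,second_countable_topology}"
  assumes "Z \<in> borel_measurable M" "\<And>\<omega>. \<omega> \<in> space M \<Longrightarrow> norm (Z \<omega>) \<le> B"
  shows "integrable M (\<lambda>\<omega>. (norm (Z \<omega>))\<^sup>2)"
proof (rule integrable_const_bound)
  show "AE \<omega> in M. norm ((norm (Z \<omega>))\<^sup>2) \<le> B\<^sup>2"
    using assms(2) by (intro AE_I2) (simp add: power_mono)
qed (use assms(1) in measurable)

lemma continuous_iterate_integrable:
  fixes h :: "real^'n \<Rightarrow> 'b::{banach,second_countable_topology}"
  assumes "continuous_on UNIV h"
  shows "integrable M (\<lambda>\<omega>. h (x k \<omega>))"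
proof -
  obtain B where "\<And>\<omega>. \<omega> \<in> space M \<Longrightarrow> norm (h (x k \<omega>)) \<le> B"
    using continuous_iterate_bounded[OF assms] by blast
  then show ?thesis
    by (intro integrable_const_bound[of _ B] borel_measurable_continuous_on[OF assms x_random]) auto
qed

lemma stepsize_measurable: "\<Delta> k \<in> borel_measurable M"
  by (rule measurable_from_subalg[OF subalgebra_history \<Delta>_measurable])

lemma stepsize_mult_integrable:
  fixes Z :: "'w \<Rightarrow> real"
  assumes "integrable M Z"
  shows "integrable M (\<lambda>\<omega>. \<Delta> k \<omega> * Z \<omega>)"
proof (rule Bochner_Integration.integrable_bound)
  show "integrable M (\<lambda>\<omega>. (\<alpha> k * \<delta>u) * Z \<omega>)"
    using assms by simp
  show "AE \<omega> in M. norm (\<Delta> k \<omega> * Z \<omega>) \<le> norm ((\<alpha> k * \<delta>u) * Z \<omega>)"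
  proof (rule AE_I2)
    fix \<omega> assume "\<omega> \<in> space M"
    then have "\<bar>\<Delta> k \<omega>\<bar> \<le> \<bar>\<alpha> k * \<delta>u\<bar>"
      using \<Delta>_pos[of \<omega> k] \<Delta>_bounds(2)[of \<omega> k] by linarith
    then show "norm (\<Delta> k \<omega> * Z \<omega>) \<le> norm ((\<alpha> k * \<delta>u) * Z \<omega>)"
      by (simp only: real_norm_def abs_mult[of _ "Z \<omega>"] mult_right_mono abs_ge_zero)
  qed
  show "(\<lambda>\<omega>. \<Delta> k \<omega> * Z \<omega>) \<in> borel_measurable M"
    using stepsize_measurable assms by measurable
qed

lemma stepsize_power2_mult_integrable:
  fixes Z :: "'w \<Rightarrow> real"
  assumes "integrable M Z"
  shows "integrable M (\<lambda>\<omega>. (\<Delta> k \<omega>)\<^sup>2 * Z \<omega>)"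
  using stepsize_mult_integrable[OF stepsize_mult_integrable[OF assms]]
  by (simp add: power2_eq_square mult.assoc)

lemma step_power2_integrable: "integrable M (\<lambda>\<omega>. (norm (x (Suc k) \<omega> - x k \<omega>))\<^sup>2)"
proof -
  obtain R R' where "\<And>\<omega>. \<omega> \<in> space M \<Longrightarrow> norm (x k \<omega>) \<le> R"
    and "\<And>\<omega>. \<omega> \<in> space M \<Longrightarrow> norm (x (Suc k) \<omega>) \<le> R'"
    using iterate_bounded by meson
  then have "norm (x (Suc k) \<omega> - x k \<omega>) \<le> R' + R" if "\<omega> \<in> space M" for \<omega>
    using that by (intro order.trans[OF norm_triangle_ineq4] add_mono)
  moreover have "(\<lambda>\<omega>. x (Suc k) \<omega> - x k \<omega>) \<in> borel_measurable M"
    by (intro borel_measurable_diff x_random)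
  ultimately show ?thesis
    by (intro bounded_norm_power2_integrable)
qed

section \<open>Normal components and the conditional second moment of a step\<close>

lemma normal_component_geometric:
  assumes eta: "\<And>k. \<eta> k \<le> \<eta>'" "\<eta>' < 1" and mu: "R_linear_to_zero \<mu>"
  obtains q E where "\<eta>' < q" "0 < q" "q < 1" "0 < E"
    "\<And>k \<omega>. \<omega> \<in> space M \<Longrightarrow> norm (row_pinv A (A *v x k \<omega> - b)) \<le> E * q ^ k"
    "\<And>k \<omega>. \<omega> \<in> space M \<Longrightarrow> norm (row_pinv A (A *v x k \<omega> - b + res k \<omega>)) \<le> E * q ^ k"
proof -
  obtain C \<rho> where \<rho>: "0 < C" "0 < \<rho>" "\<rho> < 1" "\<And>k. \<mu> k \<le> C * \<rho> ^ k"
    using mu unfolding R_linear_to_zero_def by blast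
  \<comment> \<open>One rate for both effects: above \<open>\<eta>'\<close>, so that the contraction
    is faster, and above \<open>\<rho>\<close>, so that it dominates \<open>\<mu>\<close>.\<close>
  obtain q where q: "max \<eta>' \<rho> < q" "q < 1"
    using dense[of "max \<eta>' \<rho>" 1] eta(2) \<rho>(3) by auto
  then have "\<eta>' < q" "0 < q"
    using \<rho>(2) by auto
  have "\<mu> k \<le> C * q ^ k" for k
    using \<rho> q by (intro order.trans[OF \<rho>(4)] mult_left_mono power_mono) auto
  then obtain D where D: "0 < D" "\<And>k \<omega>. \<omega> \<in> space M \<Longrightarrow> norm (A *v x k \<omega> - b) \<le> D * q ^ k"
    using infeasibility_geometric[OF eta(1) \<open>\<eta>' < q\<close>] by blast
  obtain c where c: "c > 0" "\<And>v. norm (row_pinv A v) \<le> c * norm v"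
    using linear_bounded_pos[OF linear_row_pinv] by blast
  show ?thesis
  proof (rule that[OF \<open>\<eta>' < q\<close> \<open>0 < q\<close> \<open>q < 1\<close>])
    \<comment> \<open>\<open>c\<close> bounds the operator T; the 2 leaves room for infeasibility
      and residual together.\<close>
    show "0 < c * (2 * D)"
      using c(1) D(1) by simp
    fix k \<omega> assume \<omega>: "\<omega> \<in> space M"
    have pos: "0 \<le> D * q ^ k"
      using D(1) \<open>0 < q\<close> by simp
    have "norm (A *v x k \<omega> - b) \<le> 2 * (D * q ^ k)"
      using D(2)[OF \<omega>, of k] pos by linarith
    then show "norm (row_pinv A (A *v x k \<omega> - b)) \<le> c * (2 * D) * q ^ k"
      unfolding mult.assoc using c(1) by (intro order.trans[OF c(2)] mult_left_mono) auto
    \<comment> \<open>Up to sign the residual is the next infeasibility, so it inherits the decay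
      already shown.\<close>
    have "norm (res k \<omega>) \<le> D * q ^ Suc k"
      using D(2)[OF \<omega>, of "Suc k"] unfolding infeasibility_step[OF \<omega>] by simp
    also have "\<dots> \<le> D * q ^ k"
      using D(1) \<open>0 < q\<close> \<open>q < 1\<close> by (intro mult_left_mono power_decreasing) auto
    finally have "norm (A *v x k \<omega> - b + res k \<omega>) \<le> 2 * (D * q ^ k)"
      using D(2)[OF \<omega>, of k] norm_triangle_ineq[of "A *v x k \<omega> - b" "res k \<omega>"] by linarith
    then show "norm (row_pinv A (A *v x k \<omega> - b + res k \<omega>)) \<le> c * (2 * D) * q ^ k"
      unfolding mult.assoc using c(1) by (intro order.trans[OF c(2)] mult_left_mono) auto
  qed
qed

text \<open>The kernel part of the step is split into noise and true gradient by
  \<open>(s + t)\<^sup>2 \<le> 2 * s\<^sup>2 + 2 * t\<^sup>2\<close>, the source of the factor 2 in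
  \<open>step_bound\<close>. The terms are grouped so that only the noise needs a nontrivial
  conditional expectation.\<close>

lemma norm_step_le:
  assumes \<omega>: "\<omega> \<in> space M"
    and T: "norm (row_pinv A (A *v x k \<omega> - b + res k \<omega>)) \<le> E * q ^ k"
  shows "(norm (x (Suc k) \<omega> - x k \<omega>))\<^sup>2
    \<le> (2 * (\<Delta> k \<omega>)\<^sup>2) * (norm (g k \<omega> - grad h (x k \<omega>)))\<^sup>2
      + (2 * (\<Delta> k \<omega>)\<^sup>2 * (norm (proj_grad_dir A b h (x k \<omega>)))\<^sup>2 + E\<^sup>2 * q ^ (2 * k))"
proof -
  let ?P = "null_proj A" and ?u = "g k \<omega> - grad h (x k \<omega>)" and ?v = "grad h (x k \<omega>)"
  have "(norm (?P (g k \<omega>)))\<^sup>2 = (norm (?P ?u + ?P ?v))\<^sup>2"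
    by (simp flip: linear_add[OF linear_null_proj])
  also have "\<dots> \<le> (norm (?P ?u) + norm (?P ?v))\<^sup>2"
    by (intro power_mono norm_triangle_ineq) simp
  also have "\<dots> \<le> 2 * (norm (?P ?u))\<^sup>2 + 2 * (norm (?P ?v))\<^sup>2"
    using sum_squares_bound[of "norm (?P ?u)" "norm (?P ?v)"] by (simp add: power2_sum)
  also have "\<dots> \<le> 2 * (norm ?u)\<^sup>2 + 2 * (norm (proj_grad_dir A b h (x k \<omega>)))\<^sup>2"
    unfolding norm_proj_grad_dir[OF full_row_rank]
    by (intro add_mono mult_left_mono power_mono norm_null_proj_le[OF full_row_rank]) auto
  finally have "(\<Delta> k \<omega>)\<^sup>2 * (norm (?P (g k \<omega>)))\<^sup>2
      \<le> (\<Delta> k \<omega>)\<^sup>2 * (2 * (norm ?u)\<^sup>2 + 2 * (norm (proj_grad_dir A b h (x k \<omega>)))\<^sup>2)"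
    by (rule mult_left_mono) simp
  moreover have "(norm (row_pinv A (A *v x k \<omega> - b + res k \<omega>)))\<^sup>2 \<le> E\<^sup>2 * q ^ (2 * k)"
    using power_mono[OF T norm_ge_zero, of 2]
    by (simp add: power_mult_distrib mult.commute[of 2] power_mult)
  ultimately show ?thesis
    unfolding step_eq[OF \<omega>] norm_minus_cancel norm_null_proj_row_pinv[OF full_row_rank]
    by (simp add: algebra_simps)
qed

text \<open>Conditional expectations are taken in the pathwise estimate: the squared step size is
  pulled out of the noise term, the remaining terms are known from the history, and the variance
  bound handles the noise.\<close>

lemma step_bound_exists:
  assumes F: "continuous_on UNIV (grad F)"
    and eta: "\<And>k. \<eta> k \<le> \<eta>'" "\<eta>' < 1" and mu: "R_linear_to_zero \<mu>"
    and nu: "0 < \<nu>"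
    and variance_bound:
      "\<And>k. AE \<omega> in M. real_cond_exp M (history M x k)
                        (\<lambda>\<omega>. (norm (g k \<omega> - grad F (x k \<omega>)))\<^sup>2) \<omega> \<le> \<nu>"
  shows "\<exists>\<kappa>2>0. \<exists>\<kappa>3>0. \<exists>\<kappa>4>0. \<exists>q. \<eta>' < q \<and> q < 1 \<and>
    step_bound M x \<Delta> \<mu> (proj_grad_dir A b F) \<kappa>2 \<kappa>3 \<kappa>4 q"
proof -
  obtain q E where q: "\<eta>' < q" "0 < q" "q < 1" and E: "0 < E"
    and T: "\<And>k \<omega>. \<omega> \<in> space M \<Longrightarrow> norm (row_pinv A (A *v x k \<omega> - b + res k \<omega>)) \<le> E * q ^ k"
    using normal_component_geometric[OF eta mu] by metis
  define d where "d = proj_grad_dir A b F"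
  have d: "continuous_on UNIV (\<lambda>z. (norm (d z))\<^sup>2)"
    unfolding d_def by (intro continuous_intros continuous_proj_grad_dir F)
  \<comment> \<open>\<open>2 * \<nu>\<close> comes from the doubled noise and
    \<open>E\<^sup>2\<close> from the squared normal part. That part already contains the residual,
    so by \<open>\<mu> k \<ge> 0\<close> the value 1 is good enough for the last constant.\<close>
  have "step_bound M x \<Delta> \<mu> d (2 * \<nu>) (E\<^sup>2) 1 q"
    unfolding step_bound_def
  proof
    fix k
    let ?cond = "real_cond_exp M (history M x k)"
    define V where "V \<omega> = (norm (g k \<omega> - grad F (x k \<omega>)))\<^sup>2" for \<omega>
    define W where "W \<omega> = 2 * (\<Delta> k \<omega>)\<^sup>2 * (norm (d (x k \<omega>)))\<^sup>2 + E\<^sup>2 * q ^ (2 * k)" for \<omega>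
    obtain R where "\<And>\<omega>. \<omega> \<in> space M \<Longrightarrow> norm (x k \<omega>) \<le> R"
      using iterate_bounded by blast
    then obtain G where G: "\<And>\<omega>. \<omega> \<in> space M \<Longrightarrow> norm (g k \<omega>) \<le> G"
      using sampled_gradient_bounded by blast
    obtain G' where G': "\<And>\<omega>. \<omega> \<in> space M \<Longrightarrow> norm (grad F (x k \<omega>)) \<le> G'"
      using continuous_iterate_bounded[OF F] by blast
    have V: "integrable M V"
      unfolding V_def
    proof (rule bounded_norm_power2_integrable)
      show "(\<lambda>\<omega>. g k \<omega> - grad F (x k \<omega>)) \<in> borel_measurable M"
        by (intro borel_measurable_diff sampled_gradient_measurable
            borel_measurable_continuous_on[OF F x_random])
      show "norm (g k \<omega> - grad F (x k \<omega>)) \<le> G + G'" if "\<omega> \<in> space M" for \<omega>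
        by (intro order.trans[OF norm_triangle_ineq4] add_mono G G' that)
    qed
    have DV: "integrable M (\<lambda>\<omega>. (2 * (\<Delta> k \<omega>)\<^sup>2) * V \<omega>)"
      using stepsize_power2_mult_integrable[OF V, of k] by (simp add: mult.assoc)
    have W: "integrable M W"
      using stepsize_power2_mult_integrable[OF continuous_iterate_integrable[OF d], of k k]
      unfolding W_def by (simp add: mult.assoc)
    have [measurable]: "\<Delta> k \<in> borel_measurable (history M x k)"
        "(\<lambda>\<omega>. (norm (d (x k \<omega>)))\<^sup>2) \<in> borel_measurable (history M x k)"
      by (rule \<Delta>_measurable continuous_iterate_measurable_history[OF d])+
    have "AE \<omega> in M. ?cond (\<lambda>\<omega>. (norm (x (Suc k) \<omega> - x k \<omega>))\<^sup>2) \<omega>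
        \<le> ?cond (\<lambda>\<omega>. (2 * (\<Delta> k \<omega>)\<^sup>2) * V \<omega> + W \<omega>) \<omega>"
    proof (intro history.real_cond_exp_mono AE_I2 step_power2_integrable)
      show "integrable M (\<lambda>\<omega>. (2 * (\<Delta> k \<omega>)\<^sup>2) * V \<omega> + W \<omega>)"
        using DV W by (rule Bochner_Integration.integrable_add)
    qed (unfold V_def W_def d_def, rule norm_step_le[OF _ T])
    moreover have "AE \<omega> in M. ?cond (\<lambda>\<omega>. (2 * (\<Delta> k \<omega>)\<^sup>2) * V \<omega> + W \<omega>) \<omega>
        = ?cond (\<lambda>\<omega>. (2 * (\<Delta> k \<omega>)\<^sup>2) * V \<omega>) \<omega> + ?cond W \<omega>"
      by (rule history.real_cond_exp_add[OF DV W])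
    moreover have "AE \<omega> in M. ?cond (\<lambda>\<omega>. (2 * (\<Delta> k \<omega>)\<^sup>2) * V \<omega>) \<omega> = (2 * (\<Delta> k \<omega>)\<^sup>2) * ?cond V \<omega>"
      using borel_measurable_integrable[OF V] by (intro history.real_cond_exp_mult DV) measurable
    moreover have "AE \<omega> in M. ?cond W \<omega> = W \<omega>"
      unfolding W_def by (intro history.real_cond_exp_F_meas W[unfolded W_def]) measurable
    moreover have "AE \<omega> in M. ?cond V \<omega> \<le> \<nu>"
      using variance_bound[of k] unfolding V_def .
    ultimately show "AE \<omega> in M. ?cond (\<lambda>\<omega>. (norm (x (Suc k) \<omega> - x k \<omega>))\<^sup>2) \<omega>
        \<le> 2 * \<nu> * (\<Delta> k \<omega>)\<^sup>2 + E\<^sup>2 * q ^ (2 * k) + 1 * \<mu> k + 2 * (\<Delta> k \<omega>)\<^sup>2 * (norm (d (x k \<omega>)))\<^sup>2"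
    proof eventually_elim
      case (elim \<omega>)
      have "(2 * (\<Delta> k \<omega>)\<^sup>2) * ?cond V \<omega> \<le> (2 * (\<Delta> k \<omega>)\<^sup>2) * \<nu>"
        using elim(5) by (intro mult_left_mono) auto
      then show ?case
        using elim(1-4) \<mu>_nonneg[of k] by (simp add: W_def mult.commute mult.left_commute)
    qed
  qed
  then show ?thesis
    using nu E q unfolding d_def by (intro exI[of _ "2 * \<nu>"] exI[of _ "E\<^sup>2"] exI[of _ 1] exI[of _ q] conjI) auto
qed

section \<open>Expected descent of the objective\<close>

lemma normal_step_inner_le:
  assumes \<omega>: "\<omega> \<in> space M" "0 < \<kappa>grad" "0 < q" "0 < E"
    and feasible_or_bounded: "(\<forall>k. x k \<omega> \<in> feasible_set A b) \<or> (\<forall>k. norm (h (x k \<omega>)) \<le> \<kappa>grad)"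
    and T: "norm (row_pinv A (A *v x k \<omega> - b + res k \<omega>)) \<le> E * q ^ k"
  shows "- (h (x k \<omega>) \<bullet> row_pinv A (A *v x k \<omega> - b + res k \<omega>)) \<le> \<kappa>grad * (E * q ^ k)"
  using feasible_or_bounded
proof
  assume feas: "\<forall>k. x k \<omega> \<in> feasible_set A b"
  \<comment> \<open>Feasibility of two consecutive iterates forces the residual to vanish, and with
    it the whole normal step.\<close>
  then have "A *v x k \<omega> - b = 0" "A *v x (Suc k) \<omega> - b = 0"
    unfolding feasible_set_def by auto
  then have "A *v x k \<omega> - b + res k \<omega> = 0"
    unfolding infeasibility_step[OF \<omega>(1)] by simp
  then show ?thesis
    using assms(2-4) by (simp add: linear_0[OF linear_row_pinv])
next
  assume "\<forall>k. norm (h (x k \<omega>)) \<le> \<kappa>grad"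
  then have "norm (h (x k \<omega>)) * norm (row_pinv A (A *v x k \<omega> - b + res k \<omega>)) \<le> \<kappa>grad * (E * q ^ k)"
    using T assms(2) by (intro mult_mono) auto
  then show ?thesis
    using Cauchy_Schwarz_ineq2[of "h (x k \<omega>)" "row_pinv A (A *v x k \<omega> - b + res k \<omega>)"] by linarith
qed

text \<open>The descent lemma is integrated over one step. Unbiasedness turns the linear term into a
  multiple of the squared tangential gradient, and the step-size condition lets half of the
  guaranteed decrease survive the quadratic term.\<close>

lemma expected_descent:
  fixes L :: real
  defines "F \<equiv> avg_fun N f"
  defines "d \<equiv> proj_grad_dir A b F"
  assumes smooth: "cont_diff F" "0 < L" "L-lipschitz_on UNIV (grad F)"
    and q: "0 < q" "0 < E"
    and T0: "\<And>\<omega>. \<omega> \<in> space M \<Longrightarrow> norm (row_pinv A (A *v x k \<omega> - b)) \<le> E * q ^ k"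
    and T: "\<And>\<omega>. \<omega> \<in> space M \<Longrightarrow> norm (row_pinv A (A *v x k \<omega> - b + res k \<omega>)) \<le> E * q ^ k"
    and kappa_grad: "0 < \<kappa>grad"
    and feasible_or_bounded:
      "AE \<omega> in M. (\<forall>k. x k \<omega> \<in> feasible_set A b) \<or> (\<forall>k. norm (grad F (x k \<omega>)) \<le> \<kappa>grad)"
    and alpha: "\<alpha> k \<le> \<delta>l / (2 * L * \<delta>u\<^sup>2)"
    and kappa: "0 < \<kappa>2"
    and bound: "step_bound M x \<Delta> \<mu> d \<kappa>2 \<kappa>3 \<kappa>4 q'"
  shows "(\<integral>\<omega>. F (x (Suc k) \<omega>) \<partial>M)
    \<le> (\<integral>\<omega>. F (x k \<omega>) \<partial>M) - \<alpha> k * \<delta>l / 2 * (\<integral>\<omega>. (norm (d (x k \<omega>)))\<^sup>2 \<partial>M)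
      + L / 2 * (\<kappa>2 * (\<alpha> k * \<delta>u)\<^sup>2)
      + (\<kappa>grad * (E * q ^ k) + \<alpha> k * \<delta>u * (E * q ^ k)\<^sup>2 + L / 2 * (\<kappa>3 * q' ^ (2 * k) + \<kappa>4 * \<mu> k))"
proof -
  let ?S = "\<lambda>\<omega>. (norm (x (Suc k) \<omega> - x k \<omega>))\<^sup>2" and ?d2 = "\<lambda>\<omega>. (norm (d (x k \<omega>)))\<^sup>2"
  \<comment> \<open>The history-measurable test vector for unbiasedness.\<close>
  define h where "h \<omega> = \<Delta> k \<omega> *\<^sub>R null_proj A (grad F (x k \<omega>))" for \<omega>
  define W where "W \<omega> = \<kappa>2 * (\<Delta> k \<omega>)\<^sup>2 + \<kappa>3 * q' ^ (2 * k) + \<kappa>4 * \<mu> k + 2 * (\<Delta> k \<omega>)\<^sup>2 * ?d2 \<omega>" for \<omega>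
  have diffF: "F differentiable (at z)" for z
    using smooth(1) unfolding cont_diff_def by blast
  have contF: "continuous_on UNIV F"
    using diffF by (intro continuous_at_imp_continuous_on ballI differentiable_imp_continuous_within)
  have contG: "continuous_on UNIV (grad F)"
    using smooth(1) unfolding cont_diff_def by blast
  have contP: "continuous_on UNIV (\<lambda>z. null_proj A (grad F z))"
    by (rule continuous_on_null_proj[OF contG])
  have contd: "continuous_on UNIV (\<lambda>z. (norm (d z))\<^sup>2)"
    unfolding d_def by (intro continuous_intros continuous_proj_grad_dir contG)
  have [simp]: "integrable M (\<lambda>\<omega>. F (x j \<omega>))" for j
    by (rule continuous_iterate_integrable[OF contF])
  have [simp]: "integrable M ?S"
    by (rule step_power2_integrable)
  have intd [simp]: "integrable M ?d2"
    by (rule continuous_iterate_integrable[OF contd])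
  have [simp]: "integrable M W"
    using stepsize_power2_mult_integrable[OF integrable_const[of 1], of k]
      stepsize_power2_mult_integrable[OF intd, of k]
    unfolding W_def by (simp add: mult.assoc)
  have h: "h \<in> borel_measurable (history M x k)"
    unfolding h_def
    by (intro borel_measurable_scaleR \<Delta>_measurable continuous_iterate_measurable_history contP)
  obtain B where B: "\<And>\<omega>. \<omega> \<in> space M \<Longrightarrow> norm (null_proj A (grad F (x k \<omega>))) \<le> B"
    using continuous_iterate_bounded[OF contP] by blast
  have hB: "norm (h \<omega>) \<le> \<alpha> k * \<delta>u * B" if "\<omega> \<in> space M" for \<omega>
    unfolding h_def norm_scaleR using \<Delta>_pos[OF that, of k] \<Delta>_bounds(2)[OF that, of k] B[OF that]
    by (intro mult_mono) auto
  obtain G where G: "\<And>\<omega>. \<omega> \<in> space M \<Longrightarrow> norm (g k \<omega>) \<le> G"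
    using sampled_gradient_bounded[of k] iterate_bounded[of k] by blast
  have inth: "integrable M (\<lambda>\<omega>. h \<omega> \<bullet> v \<omega>)"
    if "v \<in> borel_measurable M" "\<And>\<omega>. \<omega> \<in> space M \<Longrightarrow> norm (v \<omega>) \<le> C" for v C
  proof (rule integrable_const_bound, rule AE_I2)
    show "norm (h \<omega> \<bullet> v \<omega>) \<le> (\<alpha> k * \<delta>u * B) * C" if "\<omega> \<in> space M" for \<omega>
      unfolding real_norm_def
      using hB[OF that] \<open>\<omega> \<in> space M \<Longrightarrow> norm (v \<omega>) \<le> C\<close> that
      by (intro order.trans[OF Cauchy_Schwarz_ineq2] mult_mono) (auto intro: order.trans[OF norm_ge_zero])
    show "(\<lambda>\<omega>. h \<omega> \<bullet> v \<omega>) \<in> borel_measurable M"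
      by (intro borel_measurable_inner that(1) measurable_from_subalg[OF subalgebra_history h])
  qed
  have [simp]: "integrable M (\<lambda>\<omega>. h \<omega> \<bullet> g k \<omega>)"
    by (rule inth[OF sampled_gradient_measurable G])
  obtain G' where G': "\<And>\<omega>. \<omega> \<in> space M \<Longrightarrow> norm (grad F (x k \<omega>)) \<le> G'"
    using continuous_iterate_bounded[OF contG] by blast
  have [simp]: "integrable M (\<lambda>\<omega>. h \<omega> \<bullet> grad F (x k \<omega>))"
    by (rule inth[OF borel_measurable_continuous_on[OF contG x_random] G'])

  have "AE \<omega> in M. F (x (Suc k) \<omega>) \<le> F (x k \<omega>) - h \<omega> \<bullet> g k \<omega> + \<kappa>grad * (E * q ^ k) + L / 2 * ?S \<omega>"
    using feasible_or_bounded AE_space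
  proof eventually_elim
    case (elim \<omega>)
    let ?z = "x k \<omega>" and ?t = "row_pinv A (A *v x k \<omega> - b + res k \<omega>)"
    have "grad F ?z \<bullet> (x (Suc k) \<omega> - ?z) = - (\<Delta> k \<omega> * (grad F ?z \<bullet> null_proj A (g k \<omega>))) - grad F ?z \<bullet> ?t"
      unfolding step_eq[OF elim(2)] by (simp add: inner_add_right inner_diff_right)
    \<comment> \<open>Self-adjointness moves P from the random \<open>g k\<close> to the gradient,
      where it becomes part of \<open>h\<close>.\<close>
    also have "grad F ?z \<bullet> null_proj A (g k \<omega>) = null_proj A (grad F ?z) \<bullet> g k \<omega>"
      by (metis inner_null_proj[OF full_row_rank] inner_commute)
    finally have "grad F ?z \<bullet> (x (Suc k) \<omega> - ?z) = - (h \<omega> \<bullet> g k \<omega>) - grad F ?z \<bullet> ?t"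
      by (simp add: h_def)
    moreover have "- (grad F ?z \<bullet> ?t) \<le> \<kappa>grad * (E * q ^ k)"
      by (rule normal_step_inner_le[OF elim(2) kappa_grad q elim(1) T[OF elim(2)]])
    ultimately show ?case
      using lipschitz_grad_descent[OF diffF smooth(3), of "x (Suc k) \<omega>" ?z] by linarith
  qed
  then have "(\<integral>\<omega>. F (x (Suc k) \<omega>) \<partial>M)
      \<le> (\<integral>\<omega>. F (x k \<omega>) - h \<omega> \<bullet> g k \<omega> + \<kappa>grad * (E * q ^ k) + L / 2 * ?S \<omega> \<partial>M)"
    by (intro integral_mono_AE) simp_all
  also have "\<dots> = (\<integral>\<omega>. F (x k \<omega>) \<partial>M) - (\<integral>\<omega>. h \<omega> \<bullet> g k \<omega> \<partial>M) + \<kappa>grad * (E * q ^ k)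
      + L / 2 * (\<integral>\<omega>. ?S \<omega> \<partial>M)"
    by (simp add: prob_space)
  also have "(\<integral>\<omega>. h \<omega> \<bullet> g k \<omega> \<partial>M) = (\<integral>\<omega>. h \<omega> \<bullet> grad F (x k \<omega>) \<partial>M)"
    unfolding F_def by (rule sampled_gradient_unbiased[OF h hB])
  finally have descent: "(\<integral>\<omega>. F (x (Suc k) \<omega>) \<partial>M) \<le> (\<integral>\<omega>. F (x k \<omega>) \<partial>M)
      - (\<integral>\<omega>. h \<omega> \<bullet> grad F (x k \<omega>) \<partial>M) + \<kappa>grad * (E * q ^ k) + L / 2 * (\<integral>\<omega>. ?S \<omega> \<partial>M)" .

  \<comment> \<open>The tower property brings in the conditional bound \<open>W\<close>.\<close>
  have "(\<integral>\<omega>. ?S \<omega> \<partial>M) = (\<integral>\<omega>. real_cond_exp M (history M x k) ?S \<omega> \<partial>M)"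
    by (intro history.real_cond_exp_int(2)[symmetric]) simp
  also have "\<dots> \<le> (\<integral>\<omega>. W \<omega> \<partial>M)"
  proof (rule integral_mono_AE)
    show "AE \<omega> in M. real_cond_exp M (history M x k) ?S \<omega> \<le> W \<omega>"
      using bound unfolding step_bound_def W_def by blast
  qed (simp_all add: history.real_cond_exp_int(1))
  finally have "L / 2 * (\<integral>\<omega>. ?S \<omega> \<partial>M) \<le> L / 2 * (\<integral>\<omega>. W \<omega> \<partial>M)"
    using smooth(2) by (intro mult_left_mono) auto
  moreover have "L / 2 * (\<integral>\<omega>. W \<omega> \<partial>M) - (\<integral>\<omega>. h \<omega> \<bullet> grad F (x k \<omega>) \<partial>M)
      = (\<integral>\<omega>. L / 2 * W \<omega> - h \<omega> \<bullet> grad F (x k \<omega>) \<partial>M)"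
    by simp
  moreover have "\<dots> \<le> (\<integral>\<omega>. - (\<alpha> k * \<delta>l / 2) * ?d2 \<omega> + (L / 2 * (\<kappa>2 * (\<alpha> k * \<delta>u)\<^sup>2)
      + \<alpha> k * \<delta>u * (E * q ^ k)\<^sup>2 + L / 2 * (\<kappa>3 * q' ^ (2 * k) + \<kappa>4 * \<mu> k)) \<partial>M)"
  proof (rule integral_mono)
    fix \<omega> assume \<omega>: "\<omega> \<in> space M"
    let ?D = "\<Delta> k \<omega>"
    note D = \<Delta>_pos[OF \<omega>, of k] \<Delta>_bounds[OF \<omega>, of k]
    \<comment> \<open>The step-size condition and \<open>\<delta>l < \<delta>u\<close> give
      \<open>L * ?D \<le> 1 / 2\<close>, so \<open>?D - L * ?D\<^sup>2\<close> is at least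
      \<open>?D / 2\<close>.\<close>
    have "L * ?D \<le> L * (\<delta>l / (2 * L * \<delta>u\<^sup>2) * \<delta>u)"
      using D alpha \<delta>_bounds smooth(2)
      by (intro mult_left_mono order.trans[OF D(3)] mult_right_mono) auto
    also have "\<dots> = \<delta>l / (2 * \<delta>u)"
      using \<delta>_bounds smooth(2) by (simp add: power2_eq_square field_simps)
    also have "\<dots> \<le> 1 / 2"
      using \<delta>_bounds by (simp add: field_simps)
    finally have "?D * (1 / 2) \<le> ?D * (1 - L * ?D)"
      using D(1) by (intro mult_left_mono) auto
    then have "\<alpha> k * \<delta>l / 2 \<le> ?D - L * ?D\<^sup>2"
      using D(2) by (simp add: power2_eq_square algebra_simps)
    from mult_right_mono[OF this, of "?d2 \<omega>"]
    have A: "\<alpha> k * \<delta>l / 2 * ?d2 \<omega> \<le> ?D * ?d2 \<omega> - L * ?D\<^sup>2 * ?d2 \<omega>"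
      by (simp add: left_diff_distrib)
    have "h \<omega> \<bullet> grad F (x k \<omega>) = ?D * (norm (null_proj A (grad F (x k \<omega>))))\<^sup>2"
      unfolding h_def inner_scaleR_left power2_norm_eq_inner
      by (metis inner_null_proj[OF full_row_rank] inner_commute)
    \<comment> \<open>Pythagoras introduces the full direction \<open>d\<close> at the price of an
      infeasibility term, which \<open>N\<close> shows to be geometrically small.\<close>
    then have h: "h \<omega> \<bullet> grad F (x k \<omega>) = ?D * ?d2 \<omega> - ?D * (norm (row_pinv A (A *v x k \<omega> - b)))\<^sup>2"
      by (simp add: d_def norm_proj_grad_dir[OF full_row_rank] algebra_simps)
    have N: "?D * (norm (row_pinv A (A *v x k \<omega> - b)))\<^sup>2 \<le> \<alpha> k * \<delta>u * (E * q ^ k)\<^sup>2"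
      using D T0[OF \<omega>] by (intro mult_mono power_mono) auto
    have K: "L / 2 * (\<kappa>2 * ?D\<^sup>2) \<le> L / 2 * (\<kappa>2 * (\<alpha> k * \<delta>u)\<^sup>2)"
      using D kappa smooth(2) by (intro mult_left_mono power_mono) auto
    have "L / 2 * W \<omega> = L / 2 * (\<kappa>2 * ?D\<^sup>2) + L / 2 * (\<kappa>3 * q' ^ (2 * k) + \<kappa>4 * \<mu> k) + L * ?D\<^sup>2 * ?d2 \<omega>"
      by (simp add: W_def algebra_simps)
    then show "L / 2 * W \<omega> - h \<omega> \<bullet> grad F (x k \<omega>) \<le> - (\<alpha> k * \<delta>l / 2) * ?d2 \<omega>
        + (L / 2 * (\<kappa>2 * (\<alpha> k * \<delta>u)\<^sup>2) + \<alpha> k * \<delta>u * (E * q ^ k)\<^sup>2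
          + L / 2 * (\<kappa>3 * q' ^ (2 * k) + \<kappa>4 * \<mu> k))"
      using A h N K unfolding mult_minus_left by linarith
  qed simp_all
  moreover have "\<dots> = - (\<alpha> k * \<delta>l / 2) * (\<integral>\<omega>. ?d2 \<omega> \<partial>M) + (L / 2 * (\<kappa>2 * (\<alpha> k * \<delta>u)\<^sup>2)
      + \<alpha> k * \<delta>u * (E * q ^ k)\<^sup>2 + L / 2 * (\<kappa>3 * q' ^ (2 * k) + \<kappa>4 * \<mu> k))"
    by (simp add: prob_space)
  ultimately show ?thesis
    using descent by linarith
qed

end

text \<open>The bound is on the \<open>limsup\<close>, which exists whether or not the averages
  converge. Integrability is asserted with it because a non-integrable function has integral 0 by
  convention, and the first conjunct ensures that admissible constants exist.\<close>

theorem theorem3: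
  fixes M :: "'w measure"
    and N r :: nat
    and f :: "nat \<Rightarrow> real^'n \<Rightarrow> real"
    and A :: "real^'n^'m"
    and b :: "real^'m"
    and x0 :: "real^'n"
    and \<alpha>s \<eta>s \<mu> :: "nat \<Rightarrow> real"
    and \<delta>l \<delta>u \<Delta>0 :: real
    and batch :: "nat \<Rightarrow> 'w \<Rightarrow> nat \<Rightarrow> nat set"
    and idx :: "nat \<Rightarrow> 'w \<Rightarrow> nat"
    and g y x :: "nat \<Rightarrow> 'w \<Rightarrow> real^'n"
    and res :: "nat \<Rightarrow> 'w \<Rightarrow> real^'m"
    and \<delta> \<Delta> :: "nat \<Rightarrow> 'w \<Rightarrow> real"
    and F :: "real^'n \<Rightarrow> real"
    and d :: "real^'n \<Rightarrow> real^'n"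
    and L fstar \<eta> \<kappa>grad \<nu> \<alpha> :: real
  defines "F \<equiv> avg_fun N f"
    and "d \<equiv> proj_grad_dir A b F"
  assumes alg: "psg_leco M N f A b x0 \<alpha>s \<eta>s \<mu> \<delta>l \<delta>u \<Delta>0 r batch idx g y res \<delta> \<Delta> x"
    and smooth: "cont_diff F" "0 < L" "L-lipschitz_on UNIV (grad F)"
    and bounded_below: "\<And>z. fstar \<le> F z"
    and eta: "\<And>k. \<eta>s k \<le> \<eta>" "\<eta> < 1"
    and mu: "R_linear_to_zero \<mu>"
    and kappa_grad: "0 < \<kappa>grad"
    and feasible_or_bounded:
      "AE \<omega> in M. (\<forall>k. x k \<omega> \<in> feasible_set A b) \<or> (\<forall>k. norm (grad F (x k \<omega>)) \<le> \<kappa>grad)"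
    and nu: "0 < \<nu>"
    and variance_bound:
      "\<And>k. AE \<omega> in M. real_cond_exp M (history M x k)
                        (\<lambda>\<omega>. (norm (g k \<omega> - grad F (x k \<omega>)))\<^sup>2) \<omega> \<le> \<nu>"
    and alpha_const: "\<And>k. \<alpha>s k = \<alpha>"
    and alpha: "0 < \<alpha>" "\<alpha> \<le> \<delta>l / (2 * L * \<delta>u\<^sup>2)"
  shows "(\<exists>\<kappa>2>0. \<exists>\<kappa>3>0. \<exists>\<kappa>4>0. \<exists>q. \<eta> < q \<and> q < 1 \<and> step_bound M x \<Delta> \<mu> d \<kappa>2 \<kappa>3 \<kappa>4 q) \<and>
    (\<forall>\<kappa>2>0. (\<exists>\<kappa>3>0. \<exists>\<kappa>4>0. \<exists>q. \<eta> < q \<and> q < 1 \<and> step_bound M x \<Delta> \<mu> d \<kappa>2 \<kappa>3 \<kappa>4 q) \<longrightarrow>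
       (\<forall>k. integrable M (\<lambda>\<omega>. (norm (d (x k \<omega>)))\<^sup>2)) \<and>
       limsup (\<lambda>K. ereal (integral\<^sup>L M
                 (\<lambda>\<omega>. (1 / real K) * (\<Sum>k=0..K. (norm (d (x k \<omega>)))\<^sup>2))))
         \<le> ereal (\<alpha> * L * \<kappa>2 * \<delta>u\<^sup>2 / \<delta>l))"
proof (intro conjI allI impI)
  interpret psg_leco M N f A b x0 \<alpha>s \<eta>s \<mu> \<delta>l \<delta>u \<Delta>0 r batch idx g y res \<delta> \<Delta> x
    by (rule alg)
  have contG: "continuous_on UNIV (grad F)"
    using smooth(1) unfolding cont_diff_def by blast
  show "\<exists>\<kappa>2>0. \<exists>\<kappa>3>0. \<exists>\<kappa>4>0. \<exists>q. \<eta> < q \<and> q < 1 \<and> step_bound M x \<Delta> \<mu> d \<kappa>2 \<kappa>3 \<kappa>4 q"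
    unfolding d_def by (rule step_bound_exists[OF contG eta mu nu variance_bound])
  have intd: "integrable M (\<lambda>\<omega>. (norm (d (x k \<omega>)))\<^sup>2)" for k
    unfolding d_def
    by (rule continuous_iterate_integrable) (intro continuous_intros continuous_proj_grad_dir contG)
  then show "integrable M (\<lambda>\<omega>. (norm (d (x k \<omega>)))\<^sup>2)" for k .
  fix \<kappa>2 :: real
  assume kappa2: "0 < \<kappa>2"
    and "\<exists>\<kappa>3>0. \<exists>\<kappa>4>0. \<exists>q. \<eta> < q \<and> q < 1 \<and> step_bound M x \<Delta> \<mu> d \<kappa>2 \<kappa>3 \<kappa>4 q"
  then obtain \<kappa>3 \<kappa>4 q' where kappa: "0 < \<kappa>3" "0 < \<kappa>4" and q': "\<eta> < q'" "q' < 1"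
    and bound: "step_bound M x \<Delta> \<mu> d \<kappa>2 \<kappa>3 \<kappa>4 q'"
    by blast
  \<comment> \<open>The rate \<open>q'\<close> belongs to the given step bound, while
    \<open>q\<close> below is the decay rate of the normal components; both enter the error
    \<open>\<epsilon>\<close>.\<close>
  have "0 < q'"
    using \<eta>_nonneg[of 0] eta(1)[of 0] q'(1) by linarith
  obtain q E where q: "0 < q" "q < 1" "0 < E"
    and T0: "\<And>k \<omega>. \<omega> \<in> space M \<Longrightarrow> norm (row_pinv A (A *v x k \<omega> - b)) \<le> E * q ^ k"
    and T: "\<And>k \<omega>. \<omega> \<in> space M \<Longrightarrow> norm (row_pinv A (A *v x k \<omega> - b + res k \<omega>)) \<le> E * q ^ k"
    using normal_component_geometric[OF eta mu] by metis
  define \<epsilon> where "\<epsilon> k = \<kappa>grad * (E * q ^ k) + \<alpha> * \<delta>u * (E * q ^ k)\<^sup>2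
    + L / 2 * (\<kappa>3 * q' ^ (2 * k) + \<kappa>4 * \<mu> k)" for k
  \<comment> \<open>The averaging lemma is applied to the expected objective values, with decrease
    factor \<open>\<alpha> * \<delta>l / 2\<close>; the quotient simplifies to the claimed
    constant.\<close>
  have "limsup (\<lambda>K. ereal ((1 / real K) * (\<Sum>k=0..K. \<integral>\<omega>. (norm (d (x k \<omega>)))\<^sup>2 \<partial>M)))
      \<le> ereal (L / 2 * (\<kappa>2 * (\<alpha> * \<delta>u)\<^sup>2) / (\<alpha> * \<delta>l / 2))"
  proof (rule limsup_average_le_of_perturbed_descent)
    show "(\<integral>\<omega>. F (x (Suc k) \<omega>) \<partial>M)
        \<le> (\<integral>\<omega>. F (x k \<omega>) \<partial>M) - \<alpha> * \<delta>l / 2 * (\<integral>\<omega>. (norm (d (x k \<omega>)))\<^sup>2 \<partial>M)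
          + L / 2 * (\<kappa>2 * (\<alpha> * \<delta>u)\<^sup>2) + \<epsilon> k" for k
      using expected_descent[of L q E k \<kappa>grad \<kappa>2 \<kappa>3 \<kappa>4 q', folded F_def, folded d_def,
          OF smooth q(1,3) T0 T kappa_grad feasible_or_bounded _ kappa2 bound]
        alpha(2) unfolding \<epsilon>_def alpha_const by blast
    have contF: "continuous_on UNIV F"
      using smooth(1) unfolding cont_diff_def
      by (intro continuous_at_imp_continuous_on ballI differentiable_imp_continuous_within) blast
    show "fstar \<le> (\<integral>\<omega>. F (x k \<omega>) \<partial>M)" for k
      using integral_mono[OF integrable_const continuous_iterate_integrable[OF contF], of fstar k]
        bounded_below by (simp add: prob_space)
    show "0 < \<alpha> * \<delta>l / 2"
      using alpha(1) \<delta>_bounds by simp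
    \<comment> \<open>Even powers are rewritten as powers of squares to exhibit geometric
      series.\<close>
    have "\<epsilon> = (\<lambda>k. \<kappa>grad * (E * q ^ k) + \<alpha> * \<delta>u * (E\<^sup>2 * (q\<^sup>2) ^ k)
        + L / 2 * (\<kappa>3 * (q'\<^sup>2) ^ k + \<kappa>4 * \<mu> k))"
      by (simp add: fun_eq_iff \<epsilon>_def power_mult_distrib power_mult flip: power_even_eq)
    moreover have "summable \<dots>"
      using q q' \<open>0 < q'\<close> R_linear_to_zero_summable[OF mu \<mu>_nonneg]
      by (intro summable_add summable_mult summable_geometric) (auto simp: power_less_one_iff)
    ultimately show "summable \<epsilon>"
      by simp
    show "0 \<le> \<epsilon> k" for k
      unfolding \<epsilon>_def
      using q kappa kappa_grad alpha(1) \<delta>_bounds smooth(2) \<mu>_nonneg[of k] \<open>0 < q'\<close> by simp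
  qed
  also have "L / 2 * (\<kappa>2 * (\<alpha> * \<delta>u)\<^sup>2) / (\<alpha> * \<delta>l / 2) = \<alpha> * L * \<kappa>2 * \<delta>u\<^sup>2 / \<delta>l"
    using alpha(1) \<delta>_bounds by (simp add: power2_eq_square field_simps)
  finally show "limsup (\<lambda>K. ereal (integral\<^sup>L M
                 (\<lambda>\<omega>. (1 / real K) * (\<Sum>k=0..K. (norm (d (x k \<omega>)))\<^sup>2))))
         \<le> ereal (\<alpha> * L * \<kappa>2 * \<delta>u\<^sup>2 / \<delta>l)"
    using intd by simp
qed

end
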